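(* Let $T,L>0$, $\Omega_L=[0,T]\times[-L,L]$ and $\Omega_t=[-L,L]$. Let $\mathcal S_i$ be the midpoints of $M_i$ square cells partitioning $\Omega_L$ and $\mathcal S_t$ the midpoints of $M_t$ intervals (of equal length) partitioning $\Omega_t$, with constant quadrature weights $w_n^i=2LT/M_i$ and $w_n^t=2L/M_t$. Let $(\mathbf u_\theta,\mathbf v_\theta)$ be a network. Then for any $\lambda>0$, $$\bigl|\mathcal E_G[\theta]-\mathcal E_T[\theta;\mathcal S]\bigr|\le\bigl(C_iM_i^{-1}+C_tM_t^{-2}+\lambda C_pM_i^{-1}\bigr)^{1/2},$$ with $$C_i=\tfrac{(LT)^2}{3}\bigl\|\mathcal R_{i,\mathbf u}^2+\mathcal R_{i,\mathbf v}^2\bigr\|_{W^{2,\infty}},\qquad C_t=\tfrac{L^3}{3}\bigl\|\mathcal R_{t,\mathbf u}^2+\mathcal R_{t,\mathbf v}^2\bigr\|_{W^{2,\infty}},$$ $$C_p=\tfrac{(LT)^2}{3}\Bigl\|\sum_{|\alpha|\le1}\bigl((D^\alpha\mathbf u_\theta)^2+(D^\alpha\mathbf v_\theta)^2\bigr)\Bigr\|_{W^{2,\infty}},$$ where the $W^{2,\infty}$ norms in $C_i$ and $C_p$ are over $\Omega_L$ and the one in $C_t$ is over $\Omega_t$.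
   Context: Fix $\varepsilon>0$, $\mathbf f\in C^\infty(\mathbb R^n;\mathbb R^n)$, $\mathbf A\in\mathbb R^{n\times n}$ symmetric positive definite, and initial data $\mathbf u_0\in(H^s(\mathbb R))^n$ with $s\ge1$, $\mathbf v_0=\mathbf f(\mathbf u_0)$. A network $(\mathbf u_\theta,\mathbf v_\theta):[0,T]\times\mathbb R\to\mathbb R^n\times\mathbb R^n$ is a feed-forward neural network with smooth activation (such as $\tanh$) and parameters $\theta$. The square of a vector means its squared Euclidean norm; $D^\alpha$ is the partial derivative with multi-index $\alpha$. Residuals: $$\mathcal R_{i,\mathbf u}=\partial_t\mathbf u_\theta+\partial_x\mathbf v_\theta,\quad \mathcal R_{i,\mathbf v}=\partial_t\mathbf v_\theta+\mathbf A^2\partial_x\mathbf u_\theta-\tfrac1\varepsilon(\mathbf f(\mathbf u_\theta)-\mathbf v_\theta),\quad \mathcal R_{t,\mathbf u}=\mathbf u_\theta(0,\cdot)-\mathbf u_0,\quad \mathcal R_{t,\mathbf v}=\mathbf v_\theta(0,\cdot)-\mathbf v_0.$$ Generalization error ($\ge0$): $$\mathcal E_G[\theta]^2=\int_0^T\big(\|\mathcal R_{i,\mathbf u}(t,\cdot)\|_{L^2(\mathbb R)}^2+\|\mathcal R_{i,\mathbf v}(t,\cdot)\|_{L^2(\mathbb R)}^2\big)dt+\|\mathcal R_{t,\mathbf u}\|_{L^2(\mathbb R)}^2+\|\mathcal R_{t,\mathbf v}\|_{L^2(\mathbb R)}^2+\lambda\int_0^T\big(\|\mathbf u_\theta(t,\cdot)\|_{H^1(\mathbb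 R)}^2+\|\mathbf v_\theta(t,\cdot)\|_{H^1(\mathbb R)}^2\big)dt.$$ Training error ($\ge0$), with $\mathcal S=(\mathcal S_i,\mathcal S_t)$: $$\mathcal E_T[\theta;\mathcal S]^2=\sum_{(t_n,x_n)\in\mathcal S_i}w_n^i\bigl(\mathcal R_{i,\mathbf u}^2+\mathcal R_{i,\mathbf v}^2\bigr)(t_n,x_n)+\sum_{x_n\in\mathcal S_t}w_n^t\bigl(\mathcal R_{t,\mathbf u}^2+\mathcal R_{t,\mathbf v}^2\bigr)(x_n)+\lambda\sum_{(t_n,x_n)\in\mathcal S_i}\sum_{|\alpha|\le1}w_n^i\bigl((D^\alpha\mathbf u_\theta)^2+(D^\alpha\mathbf v_\theta)^2\bigr)(t_n,x_n).$$
   Formalization: With E_G over all of R the claim is false (zero network, u_0 supported outside [-L,L]); it is proved with E_G restricted to x in [-L,L], and for E_G over R with the |x|>L part of E_G^2 added under the root. In the |α|≤1 sums only the x-derivative is taken, matching H^1(R). *)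

theory Defs
  imports "HOL-Analysis.Analysis" "HOL-Probability.Essential_Supremum"
begin

section \<open>Smooth functions, weak derivatives, Sobolev norms\<close>

primrec C_k :: "nat \<Rightarrow> ('a::euclidean_space \<Rightarrow> 'b::real_normed_vector) \<Rightarrow> bool" where
  "C_k 0 f \<longleftrightarrow> continuous_on UNIV f"
| "C_k (Suc k) f \<longleftrightarrow> f differentiable_on UNIV \<and>
     (\<forall>b\<in>Basis. C_k k (\<lambda>x. frechet_derivative f (at x) b))"

definition smooth :: "('a::euclidean_space \<Rightarrow> 'b::real_normed_vector) \<Rightarrow> bool" where
  "smooth f \<longleftrightarrow> (\<forall>k. C_k k f)"

text \<open>Here a multi-index is a list of basis vectors, the length of the list being its order.
  Every multi-index is represented, possibly by several lists; on smooth functions permuted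
  lists give the same derivative.\<close>

primrec partial :: "'a::euclidean_space list \<Rightarrow> ('a \<Rightarrow> real) \<Rightarrow> 'a \<Rightarrow> real" where
  "partial [] f = f"
| "partial (b # bs) f = (\<lambda>x. frechet_derivative (partial bs f) (at x) b)"

definition test_function :: "'a::euclidean_space set \<Rightarrow> ('a \<Rightarrow> real) \<Rightarrow> bool" where
  "test_function U \<phi> \<longleftrightarrow> smooth \<phi> \<and> (\<exists>K. compact K \<and> K \<subseteq> U \<and> (\<forall>x. x \<notin> K \<longrightarrow> \<phi> x = 0))"

definition locally_integrable :: "'a::euclidean_space set \<Rightarrow> ('a \<Rightarrow> real) \<Rightarrow> bool" where
  "locally_integrable U g \<longleftrightarrow> (\<forall>K. compact K \<and> K \<subseteq> U \<longrightarrow> set_integrable lborel K g)"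

definition weak_derivative ::
  "'a::euclidean_space set \<Rightarrow> 'a list \<Rightarrow> ('a \<Rightarrow> real) \<Rightarrow> ('a \<Rightarrow> real) \<Rightarrow> bool" where
  "weak_derivative U bs g h \<longleftrightarrow> locally_integrable U g \<and> locally_integrable U h \<and>
     (\<forall>\<phi>. test_function U \<phi> \<longrightarrow>
        (LINT x:U|lborel. g x * partial bs \<phi> x) = (-1) ^ length bs * (LINT x:U|lborel. h x * \<phi> x))"

text \<open>The norm of \<open>W\<^sup>k\<^sup>,\<^sup>\<infinity>(U)\<close> for open \<open>U\<close>, as the maximum over all multi-indices of order at
  most \<open>k\<close> of the essential supremum of the weak derivative. The infimum ranges over
  functions that agree almost everywhere on \<open>U\<close>, and it is \<open>\<infinity>\<close> if a weak derivative does not exist.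
  So the value is \<open>\<infinity>\<close> exactly if the function is not in \<open>W\<^sup>k\<^sup>,\<^sup>\<infinity>(U)\<close>.\<close>

definition W_inf_norm :: "nat \<Rightarrow> 'a::euclidean_space set \<Rightarrow> ('a \<Rightarrow> real) \<Rightarrow> ennreal" where
  "W_inf_norm k U g =
     (SUP bs\<in>{bs. set bs \<subseteq> Basis \<and> length bs \<le> k}.
        INF h\<in>{h. weak_derivative U bs g h}.
          esssup (restrict_space lborel U) (\<lambda>x. ennreal \<bar>h x\<bar>))"

definition L2_norm_sq :: "real set \<Rightarrow> (real \<Rightarrow> real ^ 'n) \<Rightarrow> ennreal" where
  "L2_norm_sq X w = (\<integral>\<^sup>+x\<in>X. ennreal ((norm (w x))\<^sup>2) \<partial>lborel)"

text \<open>Only used for smooth \<open>w\<close>, where the weak derivative is the classical one.\<close>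

definition H1_norm_sq :: "real set \<Rightarrow> (real \<Rightarrow> real ^ 'n) \<Rightarrow> ennreal" where
  "H1_norm_sq X w = L2_norm_sq X w + L2_norm_sq X (\<lambda>x. vector_derivative w (at x))"

definition fourier :: "(real \<Rightarrow> real) \<Rightarrow> real \<Rightarrow> complex" where
  "fourier \<phi> x = (LINT \<xi>|lborel. complex_of_real (\<phi> \<xi>) * cis (- (x * \<xi>)))"

text \<open>The space \<open>H\<^sup>s(\<real>)\<close> for \<open>s \<ge> 0\<close>: \<open>g\<close> is the Fourier transform of \<open>w \<in> L\<^sup>2(\<real>)\<close> in the
  sense of distributions, without normalising factor.\<close>

definition in_H :: "real \<Rightarrow> (real \<Rightarrow> real) \<Rightarrow> bool" where
  "in_H s w \<longleftrightarrow> w \<in> borel_measurable lborel \<and> integrable lborel (\<lambda>x. (w x)\<^sup>2) \<and>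
     (\<exists>g :: real \<Rightarrow> complex. g \<in> borel_measurable lborel \<and>
        integrable lborel (\<lambda>\<xi>. (1 + \<xi>\<^sup>2) powr s * (cmod (g \<xi>))\<^sup>2) \<and>
        (\<forall>\<phi>. test_function UNIV \<phi> \<longrightarrow>
           (LINT \<xi>|lborel. g \<xi> * complex_of_real (\<phi> \<xi>)) =
           (LINT x|lborel. complex_of_real (w x) * fourier \<phi> x)))"

section \<open>Feed-forward neural networks\<close>

text \<open>A neuron consists of its list of weights and its bias.\<close>

type_synonym neuron = "real list \<times> real"

definition preactivation :: "neuron \<Rightarrow> real list \<Rightarrow> real" where
  "preactivation \<nu> y = sum_list (map2 (*) (fst \<nu>) y) + snd \<nu>"

text \<open>The output layer is affine and is indexed by the components of the pair of output vectors.\<close>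

datatype 'n params =
  Params (hidden: "neuron list list") (out_u: "'n \<Rightarrow> neuron") (out_v: "'n \<Rightarrow> neuron")

fun hidden_output :: "(real \<Rightarrow> real) \<Rightarrow> neuron list list \<Rightarrow> real list \<Rightarrow> real list" where
  "hidden_output \<sigma> [] y = y"
| "hidden_output \<sigma> (l # ls) y = hidden_output \<sigma> ls (map (\<lambda>\<nu>. \<sigma> (preactivation \<nu> y)) l)"

definition net_u :: "(real \<Rightarrow> real) \<Rightarrow> 'n::finite params \<Rightarrow> real \<times> real \<Rightarrow> real ^ 'n" where
  "net_u \<sigma> \<theta> p = (\<chi> i. preactivation (out_u \<theta> i) (hidden_output \<sigma> (hidden \<theta>) [fst p, snd p]))"

definition net_v :: "(real \<Rightarrow> real) \<Rightarrow> 'n::finite params \<Rightarrow> real \<times> real \<Rightarrow> real ^ 'n" where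
  "net_v \<sigma> \<theta> p = (\<chi> i. preactivation (out_v \<theta> i) (hidden_output \<sigma> (hidden \<theta>) [fst p, snd p]))"

fun layer_widths_ok :: "nat \<Rightarrow> neuron list list \<Rightarrow> neuron set \<Rightarrow> bool" where
  "layer_widths_ok m [] outs \<longleftrightarrow> (\<forall>\<nu>\<in>outs. length (fst \<nu>) = m)"
| "layer_widths_ok m (l # ls) outs \<longleftrightarrow>
     (\<forall>\<nu>\<in>set l. length (fst \<nu>) = m) \<and> layer_widths_ok (length l) ls outs"

definition well_formed_params :: "'n params \<Rightarrow> bool" where
  "well_formed_params \<theta> \<longleftrightarrow> layer_widths_ok 2 (hidden \<theta>) (range (out_u \<theta>) \<union> range (out_v \<theta>))"

section \<open>Residuals and errors\<close>

definition D_t :: "(real \<times> real \<Rightarrow> real ^ 'n) \<Rightarrow> real \<times> real \<Rightarrow> real ^ 'n" where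
  "D_t w p = vector_derivative (\<lambda>t. w (t, snd p)) (at (fst p))"

definition D_x :: "(real \<times> real \<Rightarrow> real ^ 'n) \<Rightarrow> real \<times> real \<Rightarrow> real ^ 'n" where
  "D_x w p = vector_derivative (\<lambda>x. w (fst p, x)) (at (snd p))"

definition R_iu ::
  "(real \<times> real \<Rightarrow> real ^ 'n) \<Rightarrow> (real \<times> real \<Rightarrow> real ^ 'n) \<Rightarrow> real \<times> real \<Rightarrow> real ^ 'n" where
  "R_iu u v p = D_t u p + D_x v p"

definition R_iv ::
  "real \<Rightarrow> (real ^ 'n \<Rightarrow> real ^ 'n) \<Rightarrow> real ^ 'n ^ 'n \<Rightarrow>
   (real \<times> real \<Rightarrow> real ^ 'n) \<Rightarrow> (real \<times> real \<Rightarrow> real ^ 'n) \<Rightarrow> real \<times> real \<Rightarrow> real ^ 'n" where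
  "R_iv \<epsilon> f A u v p = D_t v p + (A ** A) *v D_x u p - (1 / \<epsilon>) *\<^sub>R (f (u p) - v p)"

definition R_t ::
  "(real \<Rightarrow> real ^ 'n) \<Rightarrow> (real \<times> real \<Rightarrow> real ^ 'n) \<Rightarrow> real \<Rightarrow> real ^ 'n" where
  "R_t w0 w x = w (0, x) - w0 x"

definition interior_density ::
  "real \<Rightarrow> (real ^ 'n \<Rightarrow> real ^ 'n) \<Rightarrow> real ^ 'n ^ 'n \<Rightarrow>
   (real \<times> real \<Rightarrow> real ^ 'n) \<Rightarrow> (real \<times> real \<Rightarrow> real ^ 'n) \<Rightarrow> real \<times> real \<Rightarrow> real" where
  "interior_density \<epsilon> f A u v p = (norm (R_iu u v p))\<^sup>2 + (norm (R_iv \<epsilon> f A u v p))\<^sup>2"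

definition initial_density ::
  "(real \<Rightarrow> real ^ 'n) \<Rightarrow> (real \<Rightarrow> real ^ 'n) \<Rightarrow>
   (real \<times> real \<Rightarrow> real ^ 'n) \<Rightarrow> (real \<times> real \<Rightarrow> real ^ 'n) \<Rightarrow> real \<Rightarrow> real" where
  "initial_density u0 v0 u v x = (norm (R_t u0 u x))\<^sup>2 + (norm (R_t v0 v x))\<^sup>2"

text \<open>The sum over \<open>\<bar>\<alpha>\<bar> \<le> 1\<close> in the penalty term discretises the spatial \<open>H\<^sup>1\<close> norm, hence
  the multi-index \<open>\<alpha>\<close> only refers to the variable \<open>x\<close>.\<close>

definition penalty_density ::
  "(real \<times> real \<Rightarrow> real ^ 'n) \<Rightarrow> (real \<times> real \<Rightarrow> real ^ 'n) \<Rightarrow> real \<times> real \<Rightarrow> real" where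
  "penalty_density u v p =
     ((norm (u p))\<^sup>2 + (norm (v p))\<^sup>2) + ((norm (D_x u p))\<^sup>2 + (norm (D_x v p))\<^sup>2)"

text \<open>The spatial domain \<open>X\<close> is \<open>\<real>\<close> for the full error and \<open>[-L, L]\<close> for the error on the
  truncated domain. The value may be \<open>\<infinity>\<close>.\<close>

definition gen_error_sq ::
  "real set \<Rightarrow> real \<Rightarrow> real \<Rightarrow> (real ^ 'n \<Rightarrow> real ^ 'n) \<Rightarrow> real ^ 'n ^ 'n \<Rightarrow>
   (real \<Rightarrow> real ^ 'n) \<Rightarrow> (real \<Rightarrow> real ^ 'n) \<Rightarrow> real \<Rightarrow>
   (real \<times> real \<Rightarrow> real ^ 'n) \<Rightarrow> (real \<times> real \<Rightarrow> real ^ 'n) \<Rightarrow> ennreal" where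
  "gen_error_sq X T \<epsilon> f A u0 v0 lam u v =
     (\<integral>\<^sup>+t\<in>{0..T}. (L2_norm_sq X (\<lambda>x. R_iu u v (t, x)) +
                     L2_norm_sq X (\<lambda>x. R_iv \<epsilon> f A u v (t, x))) \<partial>lborel)
     + L2_norm_sq X (R_t u0 u) + L2_norm_sq X (R_t v0 v)
     + ennreal lam * (\<integral>\<^sup>+t\<in>{0..T}. (H1_norm_sq X (\<lambda>x. u (t, x)) +
                                     H1_norm_sq X (\<lambda>x. v (t, x))) \<partial>lborel)"

definition ennsqrt :: "ennreal \<Rightarrow> ennreal" where
  "ennsqrt a = (if a = top then top else ennreal (sqrt (enn2real a)))"

definition gen_error ::
  "real set \<Rightarrow> real \<Rightarrow> real \<Rightarrow> (real ^ 'n \<Rightarrow> real ^ 'n) \<Rightarrow> real ^ 'n ^ 'n \<Rightarrow>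
   (real \<Rightarrow> real ^ 'n) \<Rightarrow> (real \<Rightarrow> real ^ 'n) \<Rightarrow> real \<Rightarrow>
   (real \<times> real \<Rightarrow> real ^ 'n) \<Rightarrow> (real \<times> real \<Rightarrow> real ^ 'n) \<Rightarrow> ennreal" where
  "gen_error X T \<epsilon> f A u0 v0 lam u v = ennsqrt (gen_error_sq X T \<epsilon> f A u0 v0 lam u v)"

definition train_error ::
  "(real \<times> real) set \<Rightarrow> real set \<Rightarrow> (real \<times> real \<Rightarrow> real) \<Rightarrow> (real \<Rightarrow> real) \<Rightarrow>
   real \<Rightarrow> (real ^ 'n \<Rightarrow> real ^ 'n) \<Rightarrow> real ^ 'n ^ 'n \<Rightarrow>
   (real \<Rightarrow> real ^ 'n) \<Rightarrow> (real \<Rightarrow> real ^ 'n) \<Rightarrow> real \<Rightarrow>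
   (real \<times> real \<Rightarrow> real ^ 'n) \<Rightarrow> (real \<times> real \<Rightarrow> real ^ 'n) \<Rightarrow> real" where
  "train_error Si St wi wt \<epsilon> f A u0 v0 lam u v =
     sqrt ((\<Sum>p\<in>Si. wi p * interior_density \<epsilon> f A u v p)
           + (\<Sum>x\<in>St. wt x * initial_density u0 v0 u v x)
           + lam * (\<Sum>p\<in>Si. wi p * penalty_density u v p))"

text \<open>\<open>S\<close> is the set of midpoints of a partition of \<open>\<Omega>\<close> into cubes of equal size
  (intervals or squares in dimension one or two).\<close>

definition cube_midpoints :: "'a::euclidean_space set \<Rightarrow> 'a set \<Rightarrow> bool" where
  "cube_midpoints \<Omega> S \<longleftrightarrow>
     (\<exists>h>0. (\<lambda>p. cbox (p - (h / 2) *\<^sub>R \<Sum>Basis) (p + (h / 2) *\<^sub>R \<Sum>Basis)) ` S division_of \<Omega>)"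

end

theory Submission
  imports Defs
begin

text \<open>Only continuity of the three densities is used, together with the following consequence of a
  finite \<open>W\<^sup>2\<^sup>,\<^sup>\<infinity>\<close> norm \<open>K\<close>: the symmetric second difference \<open>g (x + \<delta>b) + g (x - \<delta>b) - 2 g x\<close> in a
  coordinate direction \<open>b\<close> is at most \<open>K \<delta>\<^sup>2\<close> in absolute value. It is obtained by testing the weak derivative with
  translates of a bump function, so it also covers the initial density, where \<open>u0\<close> is only
  continuous. Folding a cell at its midpoint turns the error of the midpoint rule into an integral of second
  differences, which gives \<open>K h\<^sup>3 / 24\<close> on an interval and \<open>K h\<^sup>4 / 12\<close> on a square of side \<open>h\<close>. Summation bounds the
  difference of the squared errors, and \<open>\<bar>\<surd>a - \<surd>b\<bar> \<le> \<surd>\<bar>a - b\<bar>\<close>.\<close>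

section \<open>Smooth bump functions\<close>

lemma C_k_const: "C_k k (\<lambda>x::'a::euclidean_space. c :: 'b::real_normed_vector)"
  by (induction k arbitrary: c) auto

lemma C_k_Suc_imp: "C_k (Suc k) f \<Longrightarrow> C_k k f"
  by (induction k arbitrary: f) (auto intro: differentiable_imp_continuous_on)

lemma C_k_inner: "C_k k (\<lambda>x::'a::euclidean_space. x \<bullet> b)"
proof (cases k)
  case (Suc m)
  have "((\<lambda>x. x \<bullet> b) has_derivative (\<lambda>h. h \<bullet> b)) (at x)" for x :: 'a
    by (auto intro!: derivative_eq_intros)
  then have "(\<lambda>x. x \<bullet> b) differentiable_on UNIV"
    and "frechet_derivative (\<lambda>x. x \<bullet> b) (at x) = (\<lambda>h. h \<bullet> b)" for x :: 'a
    by (auto simp: differentiable_on_def differentiable_def frechet_derivative_at[symmetric])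
  then show ?thesis
    using Suc by (simp add: C_k_const)
qed (auto intro!: continuous_intros)

lemma C_k_add:
  fixes f g :: "'a::euclidean_space \<Rightarrow> 'b::real_normed_vector"
  shows "C_k k f \<Longrightarrow> C_k k g \<Longrightarrow> C_k k (\<lambda>x. f x + g x)"
proof (induction k arbitrary: f g)
  case (Suc k)
  then have d: "f differentiable at x" "g differentiable at x" for x
    by (auto simp: differentiable_on_def)
  have D: "((\<lambda>x. f x + g x) has_derivative
      (\<lambda>h. frechet_derivative f (at x) h + frechet_derivative g (at x) h)) (at x)" for x
    using d by (auto intro!: has_derivative_add simp: frechet_derivative_works[symmetric])
  have "frechet_derivative (\<lambda>x. f x + g x) (at x) =
      (\<lambda>h. frechet_derivative f (at x) h + frechet_derivative g (at x) h)" for x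
    by (rule frechet_derivative_at[OF D, symmetric])
  with Suc show ?case
    by simp
qed (auto intro!: continuous_intros)

lemma C_k_mult:
  fixes f g :: "'a::euclidean_space \<Rightarrow> real"
  shows "C_k k f \<Longrightarrow> C_k k g \<Longrightarrow> C_k k (\<lambda>x. f x * g x)"
proof (induction k arbitrary: f g)
  case (Suc k)
  then have d: "f differentiable at x" "g differentiable at x" for x
    by (auto simp: differentiable_on_def)
  have D: "((\<lambda>x. f x * g x) has_derivative
      (\<lambda>h. f x * frechet_derivative g (at x) h + frechet_derivative f (at x) h * g x)) (at x)" for x
    using d by (auto intro!: has_derivative_mult simp: frechet_derivative_works[symmetric])
  have "frechet_derivative (\<lambda>x. f x * g x) (at x) =
      (\<lambda>h. f x * frechet_derivative g (at x) h + frechet_derivative f (at x) h * g x)" for x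
    by (rule frechet_derivative_at[OF D, symmetric])
  moreover have "C_k k f" "C_k k g"
    using Suc.prems C_k_Suc_imp by blast+
  ultimately show ?case
    using Suc by (auto intro!: C_k_add)
qed (auto intro!: continuous_intros)

lemma smooth_imp_continuous_on: "smooth f \<Longrightarrow> continuous_on S f"
  unfolding smooth_def by (metis C_k.simps(1) continuous_on_subset subset_UNIV)

definition flat :: "nat \<Rightarrow> real \<Rightarrow> real" where
  "flat n t = (if t > 0 then exp (- 1 / t) / t ^ n else 0)"

lemma flat_tendsto_0: "(flat n \<longlongrightarrow> 0) (at 0)"
proof -
  have "((\<lambda>t. inverse t ^ n / exp (inverse t)) \<longlongrightarrow> (0::real)) (at_right 0)"
    by (rule filterlim_compose[OF tendsto_power_div_exp_0 filterlim_inverse_at_top_right])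
  moreover have "eventually (\<lambda>t. inverse t ^ n / exp (inverse t) = flat n t) (at_right (0::real))"
    by (auto simp: eventually_at_right_less flat_def exp_minus field_simps
        intro!: eventually_mono[OF eventually_at_right_less])
  ultimately have "(flat n \<longlongrightarrow> 0) (at_right 0)"
    by (rule Lim_transform_eventually)
  moreover have "eventually (\<lambda>t. 0 = flat n t) (at_left (0::real))"
    by (auto simp: eventually_at_left_field flat_def intro!: exI[of _ "-1"])
  then have "(flat n \<longlongrightarrow> 0) (at_left 0)"
    by (rule Lim_transform_eventually[OF tendsto_const])
  ultimately show ?thesis
    by (simp add: filterlim_split_at)
qed

lemma DERIV_flat: "(flat n has_real_derivative flat (n + 2) t - real n * flat (Suc n) t) (at t)"
proof -
  consider "t > 0" | "t < 0" | "t = 0" by linarith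
  then show ?thesis
  proof cases
    case 1
    have "((\<lambda>t. exp (- 1 / t) / t ^ n) has_real_derivative
        (exp (- 1 / t) * (1 / t\<^sup>2) * t ^ n - exp (- 1 / t) * (real n * t ^ (n - 1))) / (t ^ n * t ^ n)) (at t)"
      using 1 by (auto intro!: derivative_eq_intros simp: power2_eq_square)
    also have "(exp (- 1 / t) * (1 / t\<^sup>2) * t ^ n - exp (- 1 / t) * (real n * t ^ (n - 1))) / (t ^ n * t ^ n)
        = flat (n + 2) t - real n * flat (Suc n) t"
      using 1 by (cases n) (auto simp: flat_def field_simps power2_eq_square)
    finally show ?thesis
      by (rule has_field_derivative_transform_within_open[where S = "{0<..}"]) (use 1 in \<open>auto simp: flat_def\<close>)
  next
    case 2
    have "((\<lambda>t. 0) has_real_derivative flat (n + 2) t - real n * flat (Suc n) t) (at t)"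
      using 2 by (auto simp: flat_def)
    then show ?thesis
      by (rule has_field_derivative_transform_within_open[where S = "{..<0}"]) (use 2 in \<open>auto simp: flat_def\<close>)
  next
    case 3
    have "flat n h / h = flat (Suc n) h" for h
      by (auto simp: flat_def field_simps)
    then have "(\<lambda>h. (flat n (0 + h) - flat n 0) / h) = flat (Suc n)"
      by (auto simp: flat_def)
    then have "(flat n has_real_derivative 0) (at 0)"
      using flat_tendsto_0 by (simp add: DERIV_def)
    then show ?thesis
      using 3 by (simp add: flat_def)
  qed
qed

definition bump :: "'a::euclidean_space \<Rightarrow> real \<Rightarrow> 'a \<Rightarrow> real" where
  "bump c r x = flat 0 (r\<^sup>2 - (norm (x - c))\<^sup>2)"

lemma C_k_flat_paraboloid: "C_k k (\<lambda>x::'a::euclidean_space. flat n (r\<^sup>2 - (norm (x - c))\<^sup>2))"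
proof (induction k arbitrary: n)
  have D: "((\<lambda>x. flat n (r\<^sup>2 - (norm (x - c))\<^sup>2)) has_derivative
      (\<lambda>h. (flat (n + 2) (r\<^sup>2 - (norm (x - c))\<^sup>2) + (- real n) * flat (Suc n) (r\<^sup>2 - (norm (x - c))\<^sup>2)) *
        ((- 2) * (x \<bullet> h + (- (c \<bullet> h)))))) (at x)" for x n
  proof -
    have "((\<lambda>x. r\<^sup>2 - (x - c) \<bullet> (x - c)) has_derivative (\<lambda>h. (- 2) * (x \<bullet> h + (- (c \<bullet> h))))) (at x)"
      by (auto intro!: derivative_eq_intros simp: algebra_simps inner_commute)
    from has_derivative_compose[OF this, of "flat n", OF DERIV_flat[unfolded has_field_derivative_def]]
    show ?thesis
      by (simp add: power2_norm_eq_inner algebra_simps)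
  qed
  case 0
  show ?case
    unfolding C_k.simps
    by (rule continuous_at_imp_continuous_on) (blast intro: has_derivative_continuous[OF D])
  case (Suc k)
  have "frechet_derivative (\<lambda>x. flat n (r\<^sup>2 - (norm (x - c))\<^sup>2)) (at x) =
      (\<lambda>h. (flat (n + 2) (r\<^sup>2 - (norm (x - c))\<^sup>2) + (- real n) * flat (Suc n) (r\<^sup>2 - (norm (x - c))\<^sup>2)) *
        ((- 2) * (x \<bullet> h + (- (c \<bullet> h)))))" for x
    by (rule frechet_derivative_at[OF D, symmetric])
  moreover have "(\<lambda>x. flat n (r\<^sup>2 - (norm (x - c))\<^sup>2)) differentiable_on UNIV"
    unfolding differentiable_on_def differentiable_def using D by blast
  ultimately show ?case
    using Suc by (simp only: C_k.simps) (intro conjI ballI C_k_mult C_k_add C_k_const C_k_inner; simp)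
qed

lemma smooth_bump: "smooth (bump c r)"
  unfolding smooth_def bump_def[abs_def] by (simp add: C_k_flat_paraboloid)

lemma bump_nonneg: "bump c r x \<ge> 0"
  by (simp add: bump_def flat_def)

lemma bump_pos: "dist c x < r \<Longrightarrow> bump c r x > 0"
  by (simp add: bump_def flat_def dist_norm norm_minus_commute power_strict_mono)

lemma bump_eq_0: "0 \<le> r \<Longrightarrow> r \<le> dist c x \<Longrightarrow> bump c r x = 0"
  by (simp add: bump_def flat_def dist_norm norm_minus_commute power_mono not_less)

lemma bump_translate: "bump (c + d) r x = bump c r (x - d)"
  by (simp add: bump_def algebra_simps)

lemma test_function_bump: "0 \<le> r \<Longrightarrow> cball c r \<subseteq> U \<Longrightarrow> test_function U (bump c r)"
  unfolding test_function_def
  by (auto simp: smooth_bump intro!: exI[of _ "cball c r"] bump_eq_0)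

section \<open>Second differences and weak second derivatives\<close>

lemma integral_lborel_translate:
  fixes f :: "'a::euclidean_space \<Rightarrow> real"
  assumes "f \<in> borel_measurable borel"
  shows "(LINT y|lborel. f (c + y)) = (LINT y|lborel. f y)"
  by (subst (2) lborel_distr_plus[of c, symmetric]) (use assms in \<open>simp add: integral_distr\<close>)

lemma integrable_continuous_cball_support:
  fixes f :: "'a::euclidean_space \<Rightarrow> real"
  assumes "continuous_on UNIV f" and "\<And>x. x \<notin> cball c r \<Longrightarrow> f x = 0"
  shows "integrable lborel f"
proof -
  have "integrable lborel (\<lambda>x. indicator (cball c r) x *\<^sub>R f x)"
    using assms(1) by (intro borel_integrable_compact) (auto intro: continuous_on_subset)
  also have "(\<lambda>x. indicator (cball c r) x *\<^sub>R f x) = f"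
    using assms(2) by (auto simp: indicator_def fun_eq_iff)
  finally show ?thesis .
qed

lemma set_integral_support:
  fixes f :: "'a::euclidean_space \<Rightarrow> real"
  assumes "\<And>x. x \<notin> C \<Longrightarrow> f x = 0" and "C \<subseteq> S"
  shows "(LINT x:S|lborel. f x) = (LINT x|lborel. f x)"
  unfolding set_lebesgue_integral_def
  by (rule Bochner_Integration.integral_cong) (use assms in \<open>auto simp: indicator_def\<close>)

lemma integral_cbox_eq_lborel_integral:
  fixes f :: "'a::euclidean_space \<Rightarrow> real"
  assumes "continuous_on UNIV f" and "\<And>x. x \<notin> C \<Longrightarrow> f x = 0" and "C \<subseteq> cbox lo hi"
  shows "integral (cbox lo hi) f = (LINT x|lborel. f x)"
proof -
  have "set_integrable lborel (cbox lo hi) f"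
    unfolding set_integrable_def using assms(1)
    by (intro borel_integrable_compact) (auto intro: continuous_on_subset)
  from set_borel_integral_eq_integral(2)[OF this] show ?thesis
    using set_integral_support[of C f] assms(2,3) by simp
qed

lemma frechet_derivative_zero_outside:
  assumes "closed C" and "\<And>x. x \<notin> C \<Longrightarrow> f x = 0" and "x \<notin> C"
  shows "frechet_derivative f (at x) h = 0"
proof -
  have "(f has_derivative (\<lambda>h. 0)) (at x)"
    by (rule has_derivative_transform_within_open[of "\<lambda>x. 0" _ _ _ "- C"])
      (use assms in \<open>auto simp: open_Compl\<close>)
  from frechet_derivative_at[OF this] show ?thesis
    by metis
qed

lemma frechet_derivative_translate:
  assumes "f differentiable (at (x - c))"
  shows "frechet_derivative (\<lambda>x. f (x - c)) (at x) = frechet_derivative f (at (x - c))"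
proof -
  have D: "(f has_derivative frechet_derivative f (at (x - c))) (at (x - c))"
    using assms by (simp add: frechet_derivative_works)
  have "((\<lambda>x. x - c) has_derivative (\<lambda>h. h)) (at x)"
    by (auto intro!: derivative_eq_intros)
  from has_derivative_compose[OF this D]
  have "((\<lambda>x. f (x - c)) has_derivative frechet_derivative f (at (x - c))) (at x)" .
  from frechet_derivative_at[OF this] show ?thesis
    by simp
qed

lemma DERIV_along_direction:
  fixes f :: "'a::euclidean_space \<Rightarrow> real"
  assumes "f differentiable (at (z - s *\<^sub>R b))"
  shows "((\<lambda>s. f (z - s *\<^sub>R b)) has_real_derivative - frechet_derivative f (at (z - s *\<^sub>R b)) b) (at s)"
proof -
  let ?D = "frechet_derivative f (at (z - s *\<^sub>R b))"
  have D: "(f has_derivative ?D) (at (z - s *\<^sub>R b))"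
    using assms by (simp add: frechet_derivative_works)
  have "((\<lambda>s. z - s *\<^sub>R b) has_derivative (\<lambda>h. - (h *\<^sub>R b))) (at s)"
    by (auto intro!: derivative_eq_intros)
  from has_derivative_compose[OF this D]
  have "((\<lambda>s. f (z - s *\<^sub>R b)) has_derivative (\<lambda>h. ?D (- (h *\<^sub>R b)))) (at s)" .
  moreover have "(\<lambda>h. ?D (- (h *\<^sub>R b))) = (*) (- ?D b)"
    using has_derivative_linear[OF D] by (auto simp: fun_eq_iff linear_neg linear_scale)
  ultimately show ?thesis
    by (simp add: has_field_derivative_def)
qed

lemma second_difference_le:
  fixes F :: "real \<Rightarrow> real"
  assumes F: "\<And>s. (F has_real_derivative F1 s) (at s)" and F1: "\<And>s. (F1 has_real_derivative F2 s) (at s)"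
    and le: "\<And>s. \<bar>s\<bar> \<le> \<delta> \<Longrightarrow> \<bar>F2 s\<bar> \<le> M" and "\<delta> \<ge> 0"
  shows "\<bar>F \<delta> + F (- \<delta>) - 2 * F 0\<bar> \<le> M * \<delta>\<^sup>2"
proof (cases "\<delta> = 0")
  case False
  define d where "d = (\<lambda>n::nat. if n = 0 then (\<lambda>s. F s + F (- s)) else if n = 1 then (\<lambda>s. F1 s - F1 (- s))
    else (\<lambda>s. F2 s + F2 (- s)))"
  have "((\<lambda>s. F (- s)) has_real_derivative - F1 (- s)) (at s)"
    "((\<lambda>s. F1 (- s)) has_real_derivative - F2 (- s)) (at s)" for s
    using DERIV_mirror[of F s] DERIV_mirror[of F1 s] F F1 DERIV_mirror by fastforce+
  then have "((\<lambda>s. F s + F (- s)) has_real_derivative F1 s - F1 (- s)) (at s)"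
    "((\<lambda>s. F1 s - F1 (- s)) has_real_derivative F2 s + F2 (- s)) (at s)" for s
    using F F1 by (auto intro!: derivative_eq_intros)
  then have "\<forall>m t. m < 2 \<and> 0 \<le> t \<and> t \<le> \<delta> \<longrightarrow> DERIV (d m) t :> d (Suc m) t"
    by (auto simp: d_def less_2_cases_iff)
  from Maclaurin2[of \<delta> d, OF _ refl this] False \<open>\<delta> \<ge> 0\<close>
  obtain t where t: "0 < t" "t \<le> \<delta>" "d 0 \<delta> = (\<Sum>m<2. d m 0 / fact m * \<delta> ^ m) + d 2 t / fact 2 * \<delta>\<^sup>2"
    by auto
  then have "\<bar>t\<bar> \<le> \<delta>" "\<bar>- t\<bar> \<le> \<delta>"
    by auto
  from t have eq: "F \<delta> + F (- \<delta>) - 2 * F 0 = (F2 t + F2 (- t)) / 2 * \<delta>\<^sup>2"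
    by (simp add: d_def numeral_2_eq_2)
  have "\<bar>(F2 t + F2 (- t)) / 2\<bar> \<le> M"
    using le[OF \<open>\<bar>t\<bar> \<le> \<delta>\<close>] le[OF \<open>\<bar>- t\<bar> \<le> \<delta>\<close>]
    by (auto simp: abs_le_iff field_simps)
  from mult_right_mono[OF this, of "\<delta>\<^sup>2"] show ?thesis
    unfolding eq by (simp add: abs_mult)
qed (use assms in auto)

lemma integrable_bump: "0 \<le> r \<Longrightarrow> integrable lborel (bump c r)"
  by (rule integrable_continuous_cball_support[of _ c r])
    (auto simp: bump_eq_0 smooth_imp_continuous_on[OF smooth_bump])

lemma integral_bump_pos:
  assumes "0 < r"
  shows "0 < (LINT z|lborel. bump c r z)"
proof -
  have "(LINT z|lborel. bump c r z) \<noteq> 0"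
  proof
    assume "(LINT z|lborel. bump c r z) = 0"
    then have "AE z in lborel. bump c r z = 0"
      by (subst (asm) integral_nonneg_eq_0_iff_AE) (use assms bump_nonneg in \<open>auto intro: integrable_bump\<close>)
    then have "AE z in lborel. z \<notin> ball c r"
      by eventually_elim (use bump_pos in force)
    then have "ball c r \<in> null_sets lborel"
      by (subst (asm) AE_iff_null_sets[symmetric]) auto
    then have "negligible (ball c r)"
      using negligible_iff_null_sets null_sets_completionI by blast
    then show False
      using open_not_negligible[of "ball c r"] assms by auto
  qed
  then show ?thesis
    by (simp add: less_le bump_nonneg)
qed

lemma weak_second_difference_bump:
  fixes g :: "'a::euclidean_space \<Rightarrow> real"
  assumes g: "continuous_on UNIV g" and weak: "weak_derivative U [b, b] g h"
    and h: "AE x in lborel. x \<in> U \<longrightarrow> \<bar>h x\<bar> \<le> K"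
    and "b \<in> Basis" "0 \<le> K" "0 \<le> \<delta>" "0 < r"
    and U: "\<And>s. \<bar>s\<bar> \<le> \<delta> \<Longrightarrow> cball (x + s *\<^sub>R b) r \<subseteq> U"
  shows "\<bar>LINT z|lborel. (g (x + \<delta> *\<^sub>R b + z) + g (x - \<delta> *\<^sub>R b + z) - 2 * g (x + z)) * bump 0 r z\<bar>
    \<le> K * (LINT z|lborel. bump (0::'a) r z) * \<delta>\<^sup>2"
proof -
  define \<phi> where "\<phi> = bump (0::'a) r"
  define \<phi>1 where "\<phi>1 = (\<lambda>z. frechet_derivative \<phi> (at z) b)"
  define \<phi>2 where "\<phi>2 = (\<lambda>z. frechet_derivative \<phi>1 (at z) b)"
  define I where "I = (LINT z|lborel. \<phi> z)"
  have "C_k 2 \<phi>"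
    using smooth_bump unfolding \<phi>_def smooth_def by blast
  with \<open>b \<in> Basis\<close> have d: "\<phi> differentiable_on UNIV" "\<phi>1 differentiable_on UNIV" "continuous_on UNIV \<phi>2"
    by (auto simp: numeral_2_eq_2 \<phi>1_def \<phi>2_def)
  then have dat: "\<phi> differentiable (at z)" "\<phi>1 differentiable (at z)" for z
    by (auto simp: differentiable_on_def)
  have c: "continuous_on UNIV \<phi>" "continuous_on UNIV \<phi>1"
    using d differentiable_imp_continuous_on by blast+
  have z: "\<phi> z = 0" if "z \<notin> cball 0 r" for z
    using that \<open>0 < r\<close> by (auto simp: \<phi>_def intro!: bump_eq_0)
  then have z1: "\<phi>1 z = 0" if "z \<notin> cball 0 r" for z
    unfolding \<phi>1_def using that by (intro frechet_derivative_zero_outside[of "cball 0 r"]) auto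
  then have z2: "\<phi>2 z = 0" if "z \<notin> cball 0 r" for z
    unfolding \<phi>2_def using that by (intro frechet_derivative_zero_outside[of "cball 0 r"]) auto
  have shift: "y - x - s *\<^sub>R b \<notin> cball 0 r" if "y \<notin> cball (x + s *\<^sub>R b) r" for y s
    using that by (simp add: dist_norm norm_minus_commute algebra_simps)
  have I: "(LINT y|lborel. \<phi> (y - x - s *\<^sub>R b)) = I" for s
    using integral_lborel_translate[of \<phi> "- (x + s *\<^sub>R b)"] c(1)
    by (simp add: I_def borel_measurable_continuous_onI algebra_simps)
  obtain M where M: "cball x (\<delta> + r) \<subseteq> cbox (- M) M"
    using bounded_subset_cbox_symmetric[OF bounded_cball] by blast
  have box: "cball (x + s *\<^sub>R b) r \<subseteq> cbox (- M) M" if "\<bar>s\<bar> \<le> \<delta>" for s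
  proof -
    have "dist x (x + s *\<^sub>R b) \<le> \<delta>"
      using that \<open>b \<in> Basis\<close> by (simp add: dist_norm)
    then have "cball (x + s *\<^sub>R b) r \<subseteq> cball x (\<delta> + r)"
      by (smt (verit) dist_triangle mem_cball subsetI)
    with M show ?thesis
      by blast
  qed

  define F where "F = (\<lambda>s. integral (cbox (- M) M) (\<lambda>y. g y * \<phi> (y - x - s *\<^sub>R b)))"
  define F1 where "F1 = (\<lambda>s. integral (cbox (- M) M) (\<lambda>y. g y * - \<phi>1 (y - x - s *\<^sub>R b)))"
  define F2 where "F2 = (\<lambda>s. integral (cbox (- M) M) (\<lambda>y. g y * \<phi>2 (y - x - s *\<^sub>R b)))"
  have cont: "continuous_on S (\<lambda>p. g (snd p) * \<psi> (snd p - x - fst p *\<^sub>R b))"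
    if "continuous_on UNIV \<psi>" for S :: "(real \<times> 'a) set" and \<psi> :: "'a \<Rightarrow> real"
    by (intro continuous_intros continuous_on_compose2[OF g] continuous_on_compose2[OF that]) auto
  have cont': "continuous_on S (\<lambda>y. g y * \<psi> (y - x - s *\<^sub>R b))"
    if "continuous_on UNIV \<psi>" for S s and \<psi> :: "'a \<Rightarrow> real"
    by (intro continuous_intros continuous_on_compose2[OF g] continuous_on_compose2[OF that]) auto
  have DF: "(F has_real_derivative F1 s) (at s)" for s
    unfolding F_def F1_def
  proof (rule leibniz_rule_field_derivative)
    show "((\<lambda>s. g y * \<phi> (y - x - s *\<^sub>R b)) has_real_derivative g y * - \<phi>1 (y - x - s *\<^sub>R b)) (at s)" for s y
      unfolding \<phi>1_def by (intro DERIV_cmult DERIV_along_direction dat)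
    show "(\<lambda>y. g y * \<phi> (y - x - s *\<^sub>R b)) integrable_on cbox (- M) M" for s
      by (intro integrable_continuous cont' c)
    show "continuous_on (UNIV \<times> cbox (- M) M) (\<lambda>(s, y). g y * - \<phi>1 (y - x - s *\<^sub>R b))"
      using cont[of "\<lambda>z. - \<phi>1 z"] c(2) by (auto simp: case_prod_unfold intro: continuous_intros)
  qed auto
  have DF1: "(F1 has_real_derivative F2 s) (at s)" for s
    unfolding F1_def F2_def
  proof (rule leibniz_rule_field_derivative)
    show "((\<lambda>s. g y * - \<phi>1 (y - x - s *\<^sub>R b)) has_real_derivative g y * \<phi>2 (y - x - s *\<^sub>R b)) (at s)" for s y
      using DERIV_cmult[OF DERIV_along_direction[OF dat(2)], of "- g y"] by (simp add: \<phi>2_def)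
    show "(\<lambda>y. g y * - \<phi>1 (y - x - s *\<^sub>R b)) integrable_on cbox (- M) M" for s
      by (intro integrable_continuous cont' continuous_on_minus c)
    show "continuous_on (UNIV \<times> cbox (- M) M) (\<lambda>(s, y). g y * \<phi>2 (y - x - s *\<^sub>R b))"
      using cont[of "\<phi>2"] d(3) by (auto simp: case_prod_unfold)
  qed auto

  have F2: "\<bar>F2 s\<bar> \<le> K * I" if s: "\<bar>s\<bar> \<le> \<delta>" for s
  proof -
    let ?B = "bump (x + s *\<^sub>R b) r"
    have B: "?B = (\<lambda>y. \<phi> (y - (x + s *\<^sub>R b)))"
      using bump_translate[of 0 "x + s *\<^sub>R b" r] by (auto simp: \<phi>_def)
    have "frechet_derivative ?B (at y) b = \<phi>1 (y - (x + s *\<^sub>R b))" for y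
      unfolding B \<phi>1_def by (subst frechet_derivative_translate) (use dat in auto)
    then have "partial [b, b] ?B y = \<phi>2 (y - (x + s *\<^sub>R b))" for y
      using frechet_derivative_translate[of \<phi>1 y "x + s *\<^sub>R b"] dat by (simp add: \<phi>2_def)
    then have p: "partial [b, b] ?B y = \<phi>2 (y - x - s *\<^sub>R b)" for y
      by (simp add: algebra_simps)
    have "F2 s = (LINT y|lborel. g y * \<phi>2 (y - x - s *\<^sub>R b))"
      unfolding F2_def
      by (rule integral_cbox_eq_lborel_integral[OF cont'[OF d(3)] _ box[OF s]]) (use z2 shift in auto)
    also have "\<dots> = (LINT y:U|lborel. g y * \<phi>2 (y - x - s *\<^sub>R b))"
      by (rule set_integral_support[symmetric, OF _ U[OF s]]) (use z2 shift in auto)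
    also have "\<dots> = (LINT y:U|lborel. g y * partial [b, b] ?B y)"
      by (simp only: p)
    also have "\<dots> = (-1) ^ length [b, b] * (LINT y:U|lborel. h y * ?B y)"
      using weak test_function_bump[OF less_imp_le[OF \<open>0 < r\<close>] U[OF s]]
      unfolding weak_derivative_def by blast
    finally have "\<bar>F2 s\<bar> = \<bar>LINT y|lborel. indicator U y * (h y * ?B y)\<bar>"
      by (simp add: set_lebesgue_integral_def)
    also have "\<dots> \<le> (LINT y|lborel. K * ?B y)"
    proof (cases "integrable lborel (\<lambda>y. indicator U y * (h y * ?B y))")
      case True
      have "\<bar>LINT y|lborel. indicator U y * (h y * ?B y)\<bar> \<le> (LINT y|lborel. \<bar>indicator U y * (h y * ?B y)\<bar>)"
        by (rule integral_abs_bound)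
      also have "\<dots> \<le> (LINT y|lborel. K * ?B y)"
      proof (rule integral_mono_AE)
        show "integrable lborel (\<lambda>y. K * ?B y)"
          using \<open>0 < r\<close> by (intro integrable_mult_right integrable_bump) simp
        show "AE y in lborel. \<bar>indicator U y * (h y * ?B y)\<bar> \<le> K * ?B y"
          using h by eventually_elim
            (use \<open>0 \<le> K\<close> in \<open>auto simp: indicator_def abs_mult bump_nonneg intro!: mult_mono mult_nonneg_nonneg\<close>)
      qed (use True in simp)
      finally show ?thesis .
    next
      case False
      then show ?thesis
        using \<open>0 \<le> K\<close> by (simp add: not_integrable_integral_eq bump_nonneg)
    qed
    also have "\<dots> = K * I"
      using I[of s] by (simp add: B algebra_simps)
    finally show ?thesis .
  qed

  have F: "F s = (LINT z|lborel. g (x + s *\<^sub>R b + z) * \<phi> z)" if s: "\<bar>s\<bar> \<le> \<delta>" for s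
  proof -
    have "F s = (LINT y|lborel. g y * \<phi> (y - x - s *\<^sub>R b))"
      unfolding F_def
      by (rule integral_cbox_eq_lborel_integral[OF cont'[OF c(1)] _ box[OF s]]) (use z shift in auto)
    also have "\<dots> = (LINT z|lborel. g (x + s *\<^sub>R b + z) * \<phi> z)"
      by (subst integral_lborel_translate[of _ "x + s *\<^sub>R b", symmetric])
        (use cont'[OF c(1)] in \<open>auto intro!: borel_measurable_continuous_onI\<close>)
    finally show ?thesis .
  qed
  have int: "integrable lborel (\<lambda>z. g (w + z) * \<phi> z)" for w
  proof (rule integrable_continuous_cball_support[of _ 0 r])
    show "continuous_on UNIV (\<lambda>z. g (w + z) * \<phi> z)"
      by (intro continuous_intros continuous_on_compose2[OF g] c) auto
  qed (use z in auto)
  have "F \<delta> + F (- \<delta>) - 2 * F 0 =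
    (LINT z|lborel. (g (x + \<delta> *\<^sub>R b + z) + g (x - \<delta> *\<^sub>R b + z) - 2 * g (x + z)) * \<phi> z)"
  proof -
    have "(\<lambda>z. (g (x + \<delta> *\<^sub>R b + z) + g (x - \<delta> *\<^sub>R b + z) - 2 * g (x + z)) * \<phi> z) =
        (\<lambda>z. g (x + \<delta> *\<^sub>R b + z) * \<phi> z + g (x - \<delta> *\<^sub>R b + z) * \<phi> z - 2 * (g (x + z) * \<phi> z))"
      by (simp add: algebra_simps)
    then show ?thesis
      using F[of \<delta>] F[of "- \<delta>"] F[of 0] \<open>0 \<le> \<delta>\<close> int by simp
  qed
  with second_difference_le[OF DF DF1 F2 \<open>0 \<le> \<delta>\<close>] show ?thesis
    by (simp add: I_def \<phi>_def)
qed

lemma weak_second_difference: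
  fixes g :: "'a::euclidean_space \<Rightarrow> real"
  assumes g: "continuous_on UNIV g" and weak: "weak_derivative U [b, b] g h"
    and h: "AE x in lborel. x \<in> U \<longrightarrow> \<bar>h x\<bar> \<le> K"
    and "b \<in> Basis" "0 \<le> K" "0 \<le> \<delta>"
    and U: "open U" "convex U" "x + \<delta> *\<^sub>R b \<in> U" "x - \<delta> *\<^sub>R b \<in> U"
  shows "\<bar>g (x + \<delta> *\<^sub>R b) + g (x - \<delta> *\<^sub>R b) - 2 * g x\<bar> \<le> K * \<delta>\<^sup>2"
proof (rule field_le_epsilon)
  fix \<eta> :: real assume "0 < \<eta>"
  define D where "D = (\<lambda>z. g (x + \<delta> *\<^sub>R b + z) + g (x - \<delta> *\<^sub>R b + z) - 2 * g (x + z))"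
  have D: "continuous_on S D" for S
    unfolding D_def by (intro continuous_intros continuous_on_compose2[OF g]) auto
  then obtain e where e: "e > 0" "\<And>z. dist z 0 < e \<Longrightarrow> dist (D z) (D 0) < \<eta>"
    using \<open>0 < \<eta>\<close> unfolding continuous_on_iff by (metis UNIV_I)
  define C where "C = closed_segment (x - \<delta> *\<^sub>R b) (x + \<delta> *\<^sub>R b)"
  have "C \<subseteq> U"
    unfolding C_def using U by (intro closed_segment_subset) auto
  then obtain e' where e': "e' > 0" "(\<Union>y\<in>C. cball y e') \<subseteq> U"
    using compact_subset_open_imp_cball_epsilon_subset[of C U] U(1) by (auto simp: C_def)
  define r where "r = min (e / 2) e'"
  have r: "0 < r" "r < e" "r \<le> e'"
    using e(1) e'(1) by (auto simp: r_def)
  have "x + s *\<^sub>R b \<in> C" if "\<bar>s\<bar> \<le> \<delta>" for s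
  proof (cases "\<delta> = 0")
    case False
    define w where "w = (s + \<delta>) / (2 * \<delta>)"
    have "(1 - w) *\<^sub>R (x - \<delta> *\<^sub>R b) + w *\<^sub>R (x + \<delta> *\<^sub>R b) = x + ((w + w - 1) * \<delta>) *\<^sub>R b"
      by (simp add: algebra_simps) (simp flip: scaleR_left_distrib)
    also have "(w + w - 1) * \<delta> = s"
      using False by (simp add: w_def field_simps)
    finally have "x + s *\<^sub>R b = (1 - w) *\<^sub>R (x - \<delta> *\<^sub>R b) + w *\<^sub>R (x + \<delta> *\<^sub>R b)"
      by simp
    moreover have "0 \<le> w" "w \<le> 1"
      using that False by (auto simp: w_def field_simps)
    ultimately show ?thesis
      unfolding C_def closed_segment_def by blast
  qed (use that in \<open>auto simp: C_def\<close>)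
  then have "cball (x + s *\<^sub>R b) r \<subseteq> U" if "\<bar>s\<bar> \<le> \<delta>" for s
    using e'(2) that r(3) subset_cball by blast
  from weak_second_difference_bump[OF g weak h \<open>b \<in> Basis\<close> \<open>0 \<le> K\<close> \<open>0 \<le> \<delta>\<close> \<open>0 < r\<close> this]
  have bound: "\<bar>LINT z|lborel. D z * bump 0 r z\<bar> \<le> K * (LINT z|lborel. bump (0::'a) r z) * \<delta>\<^sup>2"
    by (simp add: D_def)
  define I where "I = (LINT z|lborel. bump (0::'a) r z)"
  have "I > 0"
    unfolding I_def by (rule integral_bump_pos) (rule r)
  have intb: "integrable lborel (bump (0::'a) r)"
    using r by (intro integrable_bump) auto
  have intD: "integrable lborel (\<lambda>z. D z * bump 0 r z)"
  proof (rule integrable_continuous_cball_support[of _ 0 r])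
    show "continuous_on UNIV (\<lambda>z. D z * bump 0 r z)"
      by (intro continuous_intros D smooth_imp_continuous_on smooth_bump)
  qed (use r in \<open>auto simp: bump_eq_0\<close>)
  have "D 0 * I - (LINT z|lborel. D z * bump 0 r z) = (LINT z|lborel. (D 0 - D z) * bump 0 r z)"
    unfolding I_def using intb intD by (simp add: left_diff_distrib)
  also have "\<bar>\<dots>\<bar> \<le> (LINT z|lborel. \<bar>(D 0 - D z) * bump 0 r z\<bar>)"
    by (rule integral_abs_bound)
  also have "\<dots> \<le> (LINT z|lborel. \<eta> * bump (0::'a) r z)"
  proof (rule integral_mono)
    show "integrable lborel (\<lambda>z. \<bar>(D 0 - D z) * bump 0 r z\<bar>)"
      using intb intD by (auto simp: left_diff_distrib intro!: integrable_abs)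
    fix z :: 'a
    show "\<bar>(D 0 - D z) * bump 0 r z\<bar> \<le> \<eta> * bump 0 r z"
    proof (cases "r \<le> dist 0 z")
      case False
      then have "\<bar>D 0 - D z\<bar> \<le> \<eta>"
        using e(2)[of z] r by (auto simp: dist_real_def dist_commute)
      then show ?thesis
        by (simp add: abs_mult bump_nonneg mult_right_mono)
    qed (use r in \<open>simp add: bump_eq_0\<close>)
  qed (use intb in simp)
  also have "\<dots> = \<eta> * I"
    by (simp add: I_def)
  finally have "\<bar>D 0 * I\<bar> \<le> K * I * \<delta>\<^sup>2 + \<eta> * I"
    using bound by (simp add: I_def)
  then have "\<bar>D 0\<bar> * I \<le> (K * \<delta>\<^sup>2 + \<eta>) * I"
    using \<open>I > 0\<close> by (simp add: abs_mult algebra_simps)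
  then show "\<bar>g (x + \<delta> *\<^sub>R b) + g (x - \<delta> *\<^sub>R b) - 2 * g x\<bar> \<le> K * \<delta>\<^sup>2 + \<eta>"
    using \<open>I > 0\<close> by (simp add: D_def)
qed

lemma W_inf_norm_second_difference:
  fixes g :: "'a::euclidean_space \<Rightarrow> real"
  assumes g: "continuous_on UNIV g" and W: "W_inf_norm 2 U g \<le> ennreal K"
    and "b \<in> Basis" "0 \<le> K" "0 \<le> \<delta>"
    and U: "open U" "convex U" "x + \<delta> *\<^sub>R b \<in> closure U" "x - \<delta> *\<^sub>R b \<in> closure U"
  shows "\<bar>g (x + \<delta> *\<^sub>R b) + g (x - \<delta> *\<^sub>R b) - 2 * g x\<bar> \<le> K * \<delta>\<^sup>2"
proof -
  have weak: "\<bar>g (y + d *\<^sub>R b) + g (y - d *\<^sub>R b) - 2 * g y\<bar> \<le> K' * d\<^sup>2"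
    if "K < K'" "0 \<le> d" "y + d *\<^sub>R b \<in> U" "y - d *\<^sub>R b \<in> U" for y d K'
  proof -
    have "(INF h\<in>{h. weak_derivative U [b, b] g h}.
        esssup (restrict_space lborel U) (\<lambda>x. ennreal \<bar>h x\<bar>)) \<le> W_inf_norm 2 U g"
      unfolding W_inf_norm_def by (rule SUP_upper) (use \<open>b \<in> Basis\<close> in auto)
    also have "\<dots> < ennreal K'"
      using W that(1) \<open>0 \<le> K\<close> by (auto simp: ennreal_lessI intro: le_less_trans)
    finally obtain h where h: "weak_derivative U [b, b] g h"
      "esssup (restrict_space lborel U) (\<lambda>x. ennreal \<bar>h x\<bar>) < ennreal K'"
      by (auto simp: INF_less_iff)
    have "AE x in restrict_space lborel U. ennreal \<bar>h x\<bar> \<le> ennreal K'"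
      using esssup_AE[where M = "restrict_space lborel U" and f = "\<lambda>x. ennreal \<bar>h x\<bar>"]
      by eventually_elim (use h(2) in order)
    then have "AE x in lborel. x \<in> U \<longrightarrow> \<bar>h x\<bar> \<le> K'"
      using that(1) \<open>0 \<le> K\<close> U(1) by (subst (asm) AE_restrict_space_iff) (auto elim!: eventually_mono)
    from weak_second_difference[OF g h(1) this \<open>b \<in> Basis\<close> _ that(2) U(1,2) that(3,4)] that(1) \<open>0 \<le> K\<close>
    show ?thesis
      by simp
  qed
  obtain z where z: "z \<in> U"
    using U(3) by (metis closure_empty ex_in_conv)
  define y where "y = (\<lambda>e. x - e *\<^sub>R (x - z))"
  define d where "d = (\<lambda>e::real. (1 - e) * \<delta>)"
  have "\<bar>g (y e + d e *\<^sub>R b) + g (y e - d e *\<^sub>R b) - 2 * g (y e)\<bar> \<le> (K + e) * (d e)\<^sup>2" if "0 < e" "e \<le> 1" for e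
  proof (rule weak)
    have *: "x + c *\<^sub>R b - e *\<^sub>R (x + c *\<^sub>R b - z) \<in> U" if "x + c *\<^sub>R b \<in> closure U" for c
      using mem_interior_closure_convex_shrink[of U z "x + c *\<^sub>R b" e] U z \<open>0 < e\<close> \<open>e \<le> 1\<close> that
      by (simp add: interior_open)
    show "y e + d e *\<^sub>R b \<in> U" "y e - d e *\<^sub>R b \<in> U"
      using *[of \<delta>] *[of "- \<delta>"] U(3,4) by (simp_all add: y_def d_def algebra_simps)
  qed (use that \<open>0 \<le> \<delta>\<close> in \<open>auto simp: d_def\<close>)
  then have "eventually (\<lambda>e. \<bar>g (y e + d e *\<^sub>R b) + g (y e - d e *\<^sub>R b) - 2 * g (y e)\<bar> \<le> (K + e) * (d e)\<^sup>2) (at_right 0)"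
    by (auto simp: eventually_at_right_field intro!: exI[of _ 1])
  moreover have "((\<lambda>e. \<bar>g (y e + d e *\<^sub>R b) + g (y e - d e *\<^sub>R b) - 2 * g (y e)\<bar>) \<longlongrightarrow>
      \<bar>g (y 0 + d 0 *\<^sub>R b) + g (y 0 - d 0 *\<^sub>R b) - 2 * g (y 0)\<bar>) (at_right 0)"
  proof -
    have "continuous_on UNIV (\<lambda>e. \<bar>g (y e + d e *\<^sub>R b) + g (y e - d e *\<^sub>R b) - 2 * g (y e)\<bar>)"
      unfolding y_def d_def by (intro continuous_intros continuous_on_compose2[OF g]) auto
    then show ?thesis
      by (simp add: continuous_on_def tendsto_within_subset[OF _ subset_UNIV])
  qed
  moreover have "((\<lambda>e. (K + e) * (d e)\<^sup>2) \<longlongrightarrow> (K + 0) * (d 0)\<^sup>2) (at_right 0)"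
    unfolding d_def by (intro tendsto_intros)
  ultimately have "\<bar>g (y 0 + d 0 *\<^sub>R b) + g (y 0 - d 0 *\<^sub>R b) - 2 * g (y 0)\<bar> \<le> (K + 0) * (d 0)\<^sup>2"
    by (intro tendsto_le[OF trivial_limit_at_right_real])
  then show ?thesis
    by (simp add: y_def d_def)
qed

section \<open>The midpoint rule\<close>

lemma midpoint_rule_1d:
  fixes g :: "real \<Rightarrow> real"
  assumes g: "continuous_on UNIV g" and "0 \<le> a"
    and d: "\<And>s. 0 \<le> s \<Longrightarrow> s \<le> a \<Longrightarrow> \<bar>g (c + s) + g (c - s) - 2 * g c\<bar> \<le> K * s\<^sup>2"
  shows "\<bar>integral {c - a..c + a} g - 2 * a * g c\<bar> \<le> K * a ^ 3 / 3"
proof -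
  have int: "h integrable_on {u..v}" if "continuous_on UNIV h" for h :: "real \<Rightarrow> real" and u v
    using that by (intro integrable_continuous_real) (auto intro: continuous_on_subset)
  have cont: "continuous_on UNIV (\<lambda>s. g (c + s))" "continuous_on UNIV (\<lambda>s. g (c - s))"
    by (intro continuous_on_compose2[OF g] continuous_intros; simp)+
  have "integral {c - a..c + a} g = integral {c..c + a} g + integral {c - a..c} g"
    using Henstock_Kurzweil_Integration.integral_combine[of "c - a" c "c + a" g] \<open>0 \<le> a\<close> int[OF g] by simp
  also have "integral {c..c + a} g = integral {0..a} (\<lambda>s. g (c + s))"
    using integral_shift[where a = 0 and b = a and c = c and f = g] continuous_on_subset[OF g]
    by (simp add: o_def add.commute)
  also have "integral {c - a..c} g = integral {0..a} (\<lambda>s. g (c - s))"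
  proof -
    have "integral {0..a} (\<lambda>s. g (c - s)) = integral {- a..0} (\<lambda>s. g (c + s))"
      using Henstock_Kurzweil_Integration.integral_reflect_real[where a = 0 and b = a and f = "\<lambda>s. g (c - s)"]
      by (simp del: Henstock_Kurzweil_Integration.integral_reflect_real)
    also have "\<dots> = integral {c - a..c} g"
      using integral_shift[where a = "- a" and b = 0 and c = c and f = g] continuous_on_subset[OF g]
      by (simp add: o_def add.commute)
    finally show ?thesis by simp
  qed
  finally have "integral {c - a..c + a} g - 2 * a * g c = integral {0..a} (\<lambda>s. g (c + s) + g (c - s) - 2 * g c)"
    using int[OF cont(1)] int[OF cont(2)] \<open>0 \<le> a\<close>
    by (simp add: Henstock_Kurzweil_Integration.integral_add Henstock_Kurzweil_Integration.integral_diff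
        integrable_add integrable_const_ivl algebra_simps)
  also have "norm \<dots> \<le> integral {0..a} (\<lambda>s. K * s\<^sup>2)"
    by (rule integral_norm_bound_integral) (use d cont in \<open>auto intro!: int continuous_intros\<close>)
  also have "\<dots> = K * a ^ 3 / 3"
    by (intro integral_unique has_integral_eq_rhs[OF fundamental_theorem_of_calculus[where f = "\<lambda>s. K * s ^ 3 / 3"]])
      (use \<open>0 \<le> a\<close> in \<open>auto intro!: derivative_eq_intros simp flip: has_real_derivative_iff_has_vector_derivative\<close>)
  finally show ?thesis by simp
qed

text \<open>Integrating first in the second and then in the first variable, the midpoint rule is applied
  once per variable. Hence only the pure second differences enter.\<close>

lemma midpoint_rule_2d:
  fixes g :: "real \<times> real \<Rightarrow> real"
  assumes g: "continuous_on UNIV g" and "0 \<le> a" "0 \<le> K"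
    and d1: "\<And>s. 0 \<le> s \<Longrightarrow> s \<le> a \<Longrightarrow> \<bar>g (c + s, e) + g (c - s, e) - 2 * g (c, e)\<bar> \<le> K * s\<^sup>2"
    and d2: "\<And>s x. 0 \<le> s \<Longrightarrow> s \<le> a \<Longrightarrow> \<bar>x - c\<bar> \<le> a \<Longrightarrow>
      \<bar>g (x, e + s) + g (x, e - s) - 2 * g (x, e)\<bar> \<le> K * s\<^sup>2"
  shows "\<bar>integral (cbox (c - a, e - a) (c + a, e + a)) g - (2 * a)\<^sup>2 * g (c, e)\<bar> \<le> K * (2 * a) ^ 4 / 12"
proof -
  have cont1: "continuous_on UNIV (\<lambda>x. g (x, y))" and cont2: "continuous_on UNIV (\<lambda>y. g (x, y))" for x y
    by (intro continuous_on_compose2[OF g] continuous_intros; simp)+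
  define G where "G = (\<lambda>x. integral {e - a..e + a} (\<lambda>y. g (x, y)))"
  have G: "continuous_on {c - a..c + a} G"
    unfolding G_def cbox_interval[symmetric]
    by (rule integral_continuous_on_param) (auto intro: continuous_on_subset[OF g])
  have 0: "integral (cbox (c - a, e - a) (c + a, e + a)) g = integral {c - a..c + a} G"
    using integral_prod_continuous[of "c - a" "e - a" "c + a" "e + a" g] g
    by (auto simp: G_def cbox_interval intro: continuous_on_subset)
  have 1: "\<bar>integral {c - a..c + a} G - integral {c - a..c + a} (\<lambda>x. 2 * a * g (x, e))\<bar> \<le> K * a ^ 3 / 3 * (2 * a)"
  proof -
    have i: "G integrable_on {c - a..c + a}" "(\<lambda>x. 2 * a * g (x, e)) integrable_on {c - a..c + a}"
      using G cont1 by (auto intro!: integrable_continuous_real continuous_intros intro: continuous_on_subset)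
    have "integral {c - a..c + a} G - integral {c - a..c + a} (\<lambda>x. 2 * a * g (x, e)) =
        integral {c - a..c + a} (\<lambda>x. G x - 2 * a * g (x, e))"
      using i by (simp add: Henstock_Kurzweil_Integration.integral_diff)
    also have "norm \<dots> \<le> integral {c - a..c + a} (\<lambda>x. K * a ^ 3 / 3)"
    proof (rule integral_norm_bound_integral)
      show "norm (G x - 2 * a * g (x, e)) \<le> K * a ^ 3 / 3" if "x \<in> {c - a..c + a}" for x
        unfolding G_def real_norm_def using that
        by (intro midpoint_rule_1d cont2 \<open>0 \<le> a\<close> d2) auto
    qed (use i in \<open>auto intro: integrable_diff\<close>)
    also have "\<dots> = K * a ^ 3 / 3 * (2 * a)"
      using \<open>0 \<le> a\<close> by simp
    finally show ?thesis by simp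
  qed
  have "\<bar>integral {c - a..c + a} (\<lambda>x. g (x, e)) - 2 * a * g (c, e)\<bar> \<le> K * a ^ 3 / 3"
    using midpoint_rule_1d[OF cont1 \<open>0 \<le> a\<close> d1] by simp
  then have "2 * a * \<bar>integral {c - a..c + a} (\<lambda>x. g (x, e)) - 2 * a * g (c, e)\<bar> \<le> 2 * a * (K * a ^ 3 / 3)"
    using \<open>0 \<le> a\<close> by (intro mult_left_mono) auto
  moreover have "integral {c - a..c + a} (\<lambda>x. 2 * a * g (x, e)) - (2 * a)\<^sup>2 * g (c, e) =
      2 * a * (integral {c - a..c + a} (\<lambda>x. g (x, e)) - 2 * a * g (c, e))"
    by (simp add: power2_eq_square right_diff_distrib)
  ultimately have "\<bar>integral {c - a..c + a} (\<lambda>x. 2 * a * g (x, e)) - (2 * a)\<^sup>2 * g (c, e)\<bar> \<le> 2 * a * (K * a ^ 3 / 3)"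
    using \<open>0 \<le> a\<close> by (simp add: abs_mult)
  moreover have "K * a ^ 3 / 3 * (2 * a) + 2 * a * (K * a ^ 3 / 3) = K * (2 * a) ^ 4 / 12"
    by (simp add: power_mult_distrib power3_eq_cube power4_eq_xxxx)
  ultimately show ?thesis
    using 0 1 by linarith
qed

lemma cube_division:
  fixes h :: real and S :: "'a::euclidean_space set"
  defines "Q \<equiv> \<lambda>p. cbox (p - (h / 2) *\<^sub>R \<Sum>Basis) (p + (h / 2) *\<^sub>R (\<Sum>Basis :: 'a))"
  assumes div: "Q ` S division_of cbox lo hi" and "0 < h"
  shows "finite S" and "measure lborel (cbox lo hi) = real (card S) * h ^ DIM('a)"
    and "continuous_on UNIV g \<Longrightarrow> integral (cbox lo hi) g = (\<Sum>p\<in>S. integral (Q p) (g :: 'a \<Rightarrow> real))"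
proof -
  have Q: "Q p = cbox (p - (h / 2) *\<^sub>R \<Sum>Basis) (p - (h / 2) *\<^sub>R \<Sum>Basis + h *\<^sub>R \<Sum>Basis)" for p
    using scaleR_left_distrib[of "h / 2" "h / 2" "\<Sum>Basis :: 'a"] unfolding Q_def by (simp add: algebra_simps)
  have content: "measure lborel (Q p) = h ^ DIM('a)" for p
    unfolding Q using content_cbox_plus[of "p - (h / 2) *\<^sub>R \<Sum>Basis" h] \<open>0 < h\<close> by simp
  then have "Q p \<noteq> {}" for p
    using \<open>0 < h\<close> by (metis content_empty less_irrefl zero_less_power)
  then have inj: "inj_on Q S"
    unfolding Q_def by (auto simp: inj_on_def eq_cbox)
  show "finite S"
    using division_of_finite[OF div] inj by (simp add: finite_image_iff)
  have "measure lborel (cbox lo hi) = sum (measure lborel) (Q ` S)"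
    using additive_content_division[OF div] by simp
  then show "measure lborel (cbox lo hi) = real (card S) * h ^ DIM('a)"
    using inj by (simp add: sum.reindex content)
  show "integral (cbox lo hi) g = (\<Sum>p\<in>S. integral (Q p) g)" if "continuous_on UNIV g"
  proof -
    have "g integrable_on cbox lo hi"
      using that by (intro integrable_continuous) (auto intro: continuous_on_subset)
    from integral_combine_division_topdown[OF this div] show ?thesis
      using inj by (simp add: sum.reindex)
  qed
qed

lemma cube_midpoints_card_pos:
  assumes "cube_midpoints (cbox lo hi) S" and "0 < measure lborel (cbox lo hi)"
  shows "0 < card S"
proof -
  obtain h where "0 < h" "(\<lambda>p. cbox (p - (h / 2) *\<^sub>R \<Sum>Basis) (p + (h / 2) *\<^sub>R \<Sum>Basis)) ` S division_of cbox lo hi"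
    using assms(1) unfolding cube_midpoints_def by blast
  from cube_division(2)[OF this(2,1)] assms(2) show ?thesis
    by (cases "card S") auto
qed

lemma quadrature_error:
  fixes g :: "'a::euclidean_space \<Rightarrow> real" and S :: "'a set"
  defines "Q \<equiv> \<lambda>h p. cbox (p - (h / 2) *\<^sub>R \<Sum>Basis) (p + (h / 2) *\<^sub>R (\<Sum>Basis :: 'a))"
  assumes S: "cube_midpoints (cbox lo hi) S" and g: "continuous_on UNIV g"
    and V: "measure lborel (cbox lo hi) = V" "0 < V"
    and cell: "\<And>h p. 0 < h \<Longrightarrow> Q h p \<subseteq> cbox lo hi \<Longrightarrow>
      \<bar>integral (Q h p) g - h ^ DIM('a) * g p\<bar> \<le> K * h ^ (DIM('a) + 2)"
  obtains h where "0 < h" "V = real (card S) * h ^ DIM('a)" "0 < card S"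
    "\<bar>integral (cbox lo hi) g - (\<Sum>p\<in>S. V / real (card S) * g p)\<bar> \<le> K * V * h\<^sup>2"
proof -
  obtain h where h: "0 < h" and div: "Q h ` S division_of cbox lo hi"
    using S unfolding cube_midpoints_def Q_def by blast
  note cd = cube_division[OF div[unfolded Q_def] h]
  have "integral (cbox lo hi) g = (\<Sum>p\<in>S. integral (Q h p) g)"
    unfolding Q_def by (rule cd(3)[OF g])
  moreover
  have Vh: "V = real (card S) * h ^ DIM('a)"
    using cd(2) V by simp
  moreover have card: "0 < card S"
    using cube_midpoints_card_pos[OF S] V by simp
  ultimately have "\<bar>integral (cbox lo hi) g - (\<Sum>p\<in>S. V / real (card S) * g p)\<bar>
      = \<bar>\<Sum>p\<in>S. integral (Q h p) g - h ^ DIM('a) * g p\<bar>"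
    by (simp add: sum_subtractf)
  also have "\<dots> \<le> (\<Sum>p\<in>S. \<bar>integral (Q h p) g - h ^ DIM('a) * g p\<bar>)"
    by (rule sum_abs)
  also have "\<dots> \<le> (\<Sum>p\<in>S. K * h ^ (DIM('a) + 2))"
    using division_ofD(2)[OF div] by (intro sum_mono cell h) auto
  also have "\<dots> = K * V * h\<^sup>2"
    by (simp add: Vh power_add power2_eq_square)
  finally show ?thesis
    using that h Vh card by blast
qed

lemma ennreal_le_mult_norm_divideI:
  assumes "\<And>K. 0 \<le> K \<Longrightarrow> W \<le> ennreal K \<Longrightarrow> x \<le> c * K / real n" and "0 < c" "0 < n"
  shows "ennreal x \<le> ennreal c * W / of_nat n"
proof (cases W)
  case (real K)
  then have "ennreal x \<le> ennreal (c * K / real n)"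
    using assms(1) by (intro ennreal_leI) auto
  also have "\<dots> = ennreal c * W / of_nat n"
    using real assms(2,3) by (simp add: ennreal_of_nat_eq_real_of_nat divide_ennreal flip: ennreal_mult)
  finally show ?thesis .
next
  case top
  then show ?thesis
    using assms(2,3) by (simp add: ennreal_mult_top ennreal_top_divide)
qed

lemma quadrature_error_1d:
  fixes g :: "real \<Rightarrow> real"
  assumes S: "cube_midpoints (cbox (- L) L) S" and g: "continuous_on UNIV g" and "0 < L"
  shows "ennreal \<bar>integral (cbox (- L) L) g - (\<Sum>x\<in>S. 2 * L / real (card S) * g x)\<bar>
      \<le> ennreal (L ^ 3 / 3) * W_inf_norm 2 (box (- L) L) g / of_nat ((card S)\<^sup>2)"
proof (rule ennreal_le_mult_norm_divideI)
  have V: "measure lborel (cbox (- L) L) = 2 * L" "0 < 2 * L"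
    using \<open>0 < L\<close> by auto
  then show "0 < (card S)\<^sup>2"
    using cube_midpoints_card_pos[OF S] by simp
  fix K assume "0 \<le> K" and W: "W_inf_norm 2 (box (- L) L) g \<le> ennreal K"
  have cell: "\<bar>integral (cbox (p - (h / 2) *\<^sub>R \<Sum>Basis) (p + (h / 2) *\<^sub>R \<Sum>Basis)) g - h ^ DIM(real) * g p\<bar>
      \<le> K / 24 * h ^ (DIM(real) + 2)"
    if "0 < h" "cbox (p - (h / 2) *\<^sub>R \<Sum>Basis) (p + (h / 2) *\<^sub>R \<Sum>Basis) \<subseteq> cbox (- L) L" for h p
  proof -
    have sub: "- L \<le> p - h / 2" "p + h / 2 \<le> L"
      using that(1,2) by auto
    have "\<bar>integral {p - h / 2..p + h / 2} g - 2 * (h / 2) * g p\<bar> \<le> K * (h / 2) ^ 3 / 3"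
    proof (rule midpoint_rule_1d[OF g])
      fix s assume s: "0 \<le> s" "s \<le> h / 2"
      show "\<bar>g (p + s) + g (p - s) - 2 * g p\<bar> \<le> K * s\<^sup>2"
        using W_inf_norm_second_difference[OF g W, of 1 s p] s sub \<open>0 \<le> K\<close> \<open>0 < L\<close> by auto
    qed (use \<open>0 < h\<close> in auto)
    then show ?thesis
      by (simp add: power3_eq_cube)
  qed
  obtain h where h: "0 < h" "2 * L = real (card S) * h ^ DIM(real)" "0 < card S"
    "\<bar>integral (cbox (- L) L) g - (\<Sum>x\<in>S. 2 * L / real (card S) * g x)\<bar> \<le> K / 24 * (2 * L) * h\<^sup>2"
    using quadrature_error[OF S g V cell] by blast
  then have "h = 2 * L / real (card S)"
    by simp
  with h(4) show "\<bar>integral (cbox (- L) L) g - (\<Sum>x\<in>S. 2 * L / real (card S) * g x)\<bar>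
      \<le> L ^ 3 / 3 * K / real ((card S)\<^sup>2)"
    by (simp add: power2_eq_square power3_eq_cube algebra_simps)
qed (use \<open>0 < L\<close> in simp)

lemma quadrature_error_2d:
  fixes g :: "real \<times> real \<Rightarrow> real"
  assumes S: "cube_midpoints (cbox (0, - L) (T, L)) S" and g: "continuous_on UNIV g" and "0 < L" "0 < T"
  shows "ennreal \<bar>integral (cbox (0, - L) (T, L)) g - (\<Sum>p\<in>S. 2 * L * T / real (card S) * g p)\<bar>
      \<le> ennreal ((L * T)\<^sup>2 / 3) * W_inf_norm 2 (box (0, - L) (T, L)) g / of_nat (card S)"
proof (rule ennreal_le_mult_norm_divideI)
  have V: "measure lborel (cbox (0, - L) (T, L)) = 2 * L * T" "0 < 2 * L * T"
    using \<open>0 < L\<close> \<open>0 < T\<close> by (auto simp: content_Pair)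
  then show "0 < card S"
    using cube_midpoints_card_pos[OF S] by simp
  have B: "\<Sum>Basis = ((1, 1) :: real \<times> real)"
    by (simp add: sum_Basis_prod_eq)
  have DIM: "DIM(real \<times> real) = 2"
    by simp
  have clos: "closure (box (0, - L) (T, L)) = cbox (0, - L) (T, L)"
    using \<open>0 < L\<close> \<open>0 < T\<close> by (intro closure_box) (auto simp: box_ne_empty Basis_prod_def)
  fix K assume "0 \<le> K" and W: "W_inf_norm 2 (box (0, - L) (T, L)) g \<le> ennreal K"
  have cell: "\<bar>integral (cbox (p - (h / 2) *\<^sub>R \<Sum>Basis) (p + (h / 2) *\<^sub>R \<Sum>Basis)) g - h ^ DIM(real \<times> real) * g p\<bar>
      \<le> K / 12 * h ^ (DIM(real \<times> real) + 2)"
    if "0 < h" "cbox (p - (h / 2) *\<^sub>R \<Sum>Basis) (p + (h / 2) *\<^sub>R \<Sum>Basis) \<subseteq> cbox (0, - L) (T, L)" for h p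
  proof -
    obtain c e where p: "p = (c, e)"
      by (cases p)
    have "cbox (c - h / 2, e - h / 2) (c + h / 2, e + h / 2) \<subseteq> cbox (0, - L) (T, L)"
      using that(2) by (simp add: B p)
    moreover have "(c - h / 2, e - h / 2) \<in> cbox (c - h / 2, e - h / 2) (c + h / 2, e + h / 2)"
      "(c + h / 2, e + h / 2) \<in> cbox (c - h / 2, e - h / 2) (c + h / 2, e + h / 2)"
      using \<open>0 < h\<close> by (auto simp: cbox_Pair_eq)
    ultimately have "(c - h / 2, e - h / 2) \<in> cbox (0, - L) (T, L)" "(c + h / 2, e + h / 2) \<in> cbox (0, - L) (T, L)"
      by blast+
    then have sub: "0 \<le> c - h / 2" "c + h / 2 \<le> T" "- L \<le> e - h / 2" "e + h / 2 \<le> L"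
      by (auto simp: cbox_Pair_eq)
    have "\<bar>integral (cbox (c - h / 2, e - h / 2) (c + h / 2, e + h / 2)) g - (2 * (h / 2))\<^sup>2 * g (c, e)\<bar>
        \<le> K * (2 * (h / 2)) ^ 4 / 12"
    proof (rule midpoint_rule_2d[OF g _ \<open>0 \<le> K\<close>])
      show "\<bar>g (c + s, e) + g (c - s, e) - 2 * g (c, e)\<bar> \<le> K * s\<^sup>2" if "0 \<le> s" "s \<le> h / 2" for s
        using W_inf_norm_second_difference[OF g W _ _ _ open_box convex_box(2), of "(1, 0)" s "(c, e)"] that sub \<open>0 \<le> K\<close> \<open>0 < h\<close>
        by (auto simp: clos cbox_Pair_eq Basis_prod_def)
      show "\<bar>g (x, e + s) + g (x, e - s) - 2 * g (x, e)\<bar> \<le> K * s\<^sup>2"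
        if "0 \<le> s" "s \<le> h / 2" "\<bar>x - c\<bar> \<le> h / 2" for s x
      proof -
        have "0 \<le> x" "x \<le> T"
          using that(3) sub by linarith+
        then show ?thesis
          using W_inf_norm_second_difference[OF g W _ _ _ open_box convex_box(2), of "(0, 1)" s "(x, e)"] that sub \<open>0 \<le> K\<close> \<open>0 < h\<close>
          by (simp add: clos cbox_Pair_eq Basis_prod_def)
      qed
    qed (use \<open>0 < h\<close> in auto)
    then show ?thesis
      by (simp add: B DIM p power2_eq_square power4_eq_xxxx)
  qed
  obtain h where h: "0 < h" "2 * L * T = real (card S) * h ^ DIM(real \<times> real)" "0 < card S"
    "\<bar>integral (cbox (0, - L) (T, L)) g - (\<Sum>p\<in>S. 2 * L * T / real (card S) * g p)\<bar>
      \<le> K / 12 * (2 * L * T) * h\<^sup>2"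
    using quadrature_error[OF S g V cell] by blast
  then have h2: "h\<^sup>2 = 2 * L * T / real (card S)"
    by (simp add: power2_eq_square)
  have "K / 12 * (2 * L * T) * h\<^sup>2 = (L * T)\<^sup>2 / 3 * K / real (card S)"
    unfolding h2 by (simp add: power2_eq_square)
  with h(4) show "\<bar>integral (cbox (0, - L) (T, L)) g - (\<Sum>p\<in>S. 2 * L * T / real (card S) * g p)\<bar>
      \<le> (L * T)\<^sup>2 / 3 * K / real (card S)"
    by (simp only:)
qed (use \<open>0 < L\<close> \<open>0 < T\<close> in simp)

section \<open>Regularity of the network and the errors\<close>

definition partially_C1 :: "(real \<times> real \<Rightarrow> real) \<Rightarrow> bool" where
  "partially_C1 w \<longleftrightarrow> continuous_on UNIV w \<and> (\<exists>wt wx. continuous_on UNIV wt \<and> continuous_on UNIV wx \<and>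
     (\<forall>t x. ((\<lambda>t. w (t, x)) has_real_derivative wt (t, x)) (at t) \<and>
            ((\<lambda>x. w (t, x)) has_real_derivative wx (t, x)) (at x)))"

lemma partially_C1I:
  assumes "continuous_on UNIV w" "continuous_on UNIV wt" "continuous_on UNIV wx"
    and "\<And>t x. ((\<lambda>t. w (t, x)) has_real_derivative wt (t, x)) (at t)"
    and "\<And>t x. ((\<lambda>x. w (t, x)) has_real_derivative wx (t, x)) (at x)"
  shows "partially_C1 w"
  unfolding partially_C1_def using assms by blast

lemma partially_C1E:
  assumes "partially_C1 w"
  obtains wt wx where "continuous_on UNIV w" "continuous_on UNIV wt" "continuous_on UNIV wx"
    and "\<And>t x. ((\<lambda>t. w (t, x)) has_real_derivative wt (t, x)) (at t)"
    and "\<And>t x. ((\<lambda>x. w (t, x)) has_real_derivative wx (t, x)) (at x)"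
  using assms unfolding partially_C1_def by blast

lemma partially_C1_const: "partially_C1 (\<lambda>p. c)"
  by (rule partially_C1I[where wt = "\<lambda>_. 0" and wx = "\<lambda>_. 0"]) auto

lemma partially_C1_fst: "partially_C1 fst"
  by (rule partially_C1I[where wt = "\<lambda>_. 1" and wx = "\<lambda>_. 0"]) (auto intro: continuous_intros)

lemma partially_C1_snd: "partially_C1 snd"
  by (rule partially_C1I[where wt = "\<lambda>_. 0" and wx = "\<lambda>_. 1"]) (auto intro: continuous_intros)

lemma partially_C1_add:
  assumes "partially_C1 w" "partially_C1 z"
  shows "partially_C1 (\<lambda>p. w p + z p)"
proof -
  obtain wt wx where w: "continuous_on UNIV w" "continuous_on UNIV wt" "continuous_on UNIV wx"
    "\<And>t x. ((\<lambda>t. w (t, x)) has_real_derivative wt (t, x)) (at t)"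
    "\<And>t x. ((\<lambda>x. w (t, x)) has_real_derivative wx (t, x)) (at x)"
    using assms(1) by (rule partially_C1E) (rule that)
  obtain zt zx where z: "continuous_on UNIV z" "continuous_on UNIV zt" "continuous_on UNIV zx"
    "\<And>t x. ((\<lambda>t. z (t, x)) has_real_derivative zt (t, x)) (at t)"
    "\<And>t x. ((\<lambda>x. z (t, x)) has_real_derivative zx (t, x)) (at x)"
    using assms(2) by (rule partially_C1E) (rule that)
  show ?thesis
    by (rule partially_C1I[where wt = "\<lambda>p. wt p + zt p" and wx = "\<lambda>p. wx p + zx p"])
      (intro continuous_on_add DERIV_add w z)+
qed

lemma partially_C1_compose:
  assumes \<sigma>: "continuous_on UNIV \<sigma>'" "\<And>y. (\<sigma> has_real_derivative \<sigma>' y) (at y)"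
    and "partially_C1 w"
  shows "partially_C1 (\<lambda>p. \<sigma> (w p))"
proof -
  obtain wt wx where w: "continuous_on UNIV w" "continuous_on UNIV wt" "continuous_on UNIV wx"
    "\<And>t x. ((\<lambda>t. w (t, x)) has_real_derivative wt (t, x)) (at t)"
    "\<And>t x. ((\<lambda>x. w (t, x)) has_real_derivative wx (t, x)) (at x)"
    using assms(3) by (rule partially_C1E) (rule that)
  have \<sigma>c: "continuous_on UNIV \<sigma>"
    using \<sigma>(2) DERIV_isCont continuous_at_imp_continuous_on by blast
  show ?thesis
  proof (rule partially_C1I[where wt = "\<lambda>p. \<sigma>' (w p) * wt p" and wx = "\<lambda>p. \<sigma>' (w p) * wx p"])
    show "continuous_on UNIV (\<lambda>p. \<sigma> (w p))" "continuous_on UNIV (\<lambda>p. \<sigma>' (w p) * wt p)"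
      "continuous_on UNIV (\<lambda>p. \<sigma>' (w p) * wx p)"
      by (intro continuous_on_mult w continuous_on_compose2[OF \<sigma>c w(1)] continuous_on_compose2[OF \<sigma>(1) w(1)]; simp)+
  qed (use DERIV_chain2[OF \<sigma>(2)] w in blast)+
qed

lemma partially_C1_preactivation:
  assumes "\<forall>w\<in>set ws. partially_C1 w"
  shows "partially_C1 (\<lambda>p. preactivation \<nu> (map (\<lambda>w. w p) ws))"
proof -
  have "partially_C1 (\<lambda>p. sum_list (map2 (*) cs (map (\<lambda>w. w p) ws)))" for cs
    using assms
  proof (induction ws arbitrary: cs)
    case (Cons w ws)
    show ?case
    proof (cases cs)
      case (Cons c cs')
      have "partially_C1 (\<lambda>p. c * w p)"
        using Cons.prems by (intro partially_C1_compose[where \<sigma> = "(*) c" and \<sigma>' = "\<lambda>_. c"])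
          (auto intro!: derivative_eq_intros)
      moreover have "partially_C1 (\<lambda>p. sum_list (map2 (*) cs' (map (\<lambda>w. w p) ws)))"
        using Cons.IH Cons.prems by simp
      ultimately show ?thesis
        using Cons by (simp add: partially_C1_add)
    qed (simp add: partially_C1_const)
  qed (simp add: partially_C1_const)
  then show ?thesis
    unfolding preactivation_def by (intro partially_C1_add partially_C1_const)
qed

lemma hidden_output_partially_C1:
  assumes \<sigma>: "continuous_on UNIV \<sigma>'" "\<And>y. (\<sigma> has_real_derivative \<sigma>' y) (at y)"
    and "\<forall>w\<in>set ws. partially_C1 w"
  obtains zs where "\<forall>z\<in>set zs. partially_C1 z"
    "\<And>p. hidden_output \<sigma> ls (map (\<lambda>w. w p) ws) = map (\<lambda>z. z p) zs"
  using assms(3)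
proof (induction ls arbitrary: ws thesis)
  case (Cons l ls)
  let ?ys = "map (\<lambda>\<nu> p. \<sigma> (preactivation \<nu> (map (\<lambda>w. w p) ws))) l"
  have "\<forall>y\<in>set ?ys. partially_C1 y"
    using partially_C1_compose[OF \<sigma> partially_C1_preactivation[OF Cons.prems(2)]] by auto
  from Cons.IH[OF _ this] obtain zs where "\<forall>z\<in>set zs. partially_C1 z"
    "\<And>p. hidden_output \<sigma> ls (map (\<lambda>w. w p) ?ys) = map (\<lambda>z. z p) zs"
    by blast
  then show ?case
    by (intro Cons.prems(1)[of zs]) (auto simp: o_def)
qed auto

lemma has_vector_derivative_vec:
  fixes w :: "real \<Rightarrow> real ^ 'n"
  assumes "\<And>i. ((\<lambda>t. w t $ i) has_real_derivative d $ i) (at t)"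
  shows "(w has_vector_derivative d) (at t)"
  unfolding has_vector_derivative_def
proof (subst has_derivative_componentwise_within, rule ballI)
  fix b :: "real ^ 'n" assume "b \<in> Basis"
  then obtain i where "b = axis i 1"
    by (auto simp: Basis_vec_def)
  then show "((\<lambda>t. w t \<bullet> b) has_derivative (\<lambda>x. x *\<^sub>R d \<bullet> b)) (at t)"
    using assms[of i] by (simp add: inner_axis has_field_derivative_def mult.commute[of _ "d $ i"])
qed

lemma network_partial_derivatives_continuous:
  fixes w :: "real \<times> real \<Rightarrow> real ^ 'n"
  assumes "smooth \<sigma>" and w: "\<And>p i. w p $ i = preactivation (out i) (hidden_output \<sigma> ls [fst p, snd p])"
  shows "continuous_on UNIV w" "continuous_on UNIV (D_t w)" "continuous_on UNIV (D_x w)"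
proof -
  have "C_k 1 \<sigma>"
    using \<open>smooth \<sigma>\<close> by (simp add: smooth_def)
  then have \<sigma>: "\<sigma> differentiable (at y)" "continuous_on UNIV (\<lambda>y. frechet_derivative \<sigma> (at y) 1)" for y
    by (auto simp: differentiable_on_def)
  have d\<sigma>: "(\<sigma> has_real_derivative frechet_derivative \<sigma> (at y) 1) (at y)" for y
  proof -
    have D: "(\<sigma> has_derivative frechet_derivative \<sigma> (at y)) (at y)"
      using \<sigma>(1) by (simp add: frechet_derivative_works)
    have "frechet_derivative \<sigma> (at y) h = frechet_derivative \<sigma> (at y) 1 * h" for h
      using linear_scale[OF has_derivative_linear[OF D], of h 1] by (simp add: mult.commute)
    with D show ?thesis
      unfolding has_field_derivative_def by (metis (no_types, lifting) ext)
  qed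
  obtain zs where zs: "\<forall>z\<in>set zs. partially_C1 z"
    "\<And>p. hidden_output \<sigma> ls (map (\<lambda>w. w p) [fst, snd]) = map (\<lambda>z. z p) zs"
    by (rule hidden_output_partially_C1[OF \<sigma>(2) d\<sigma>, of "[fst, snd]" ls]) (auto intro: partially_C1_fst partially_C1_snd)
  have C1: "partially_C1 (\<lambda>p. w p $ i)" for i
    using partially_C1_preactivation[OF zs(1), of "out i"] zs(2) by (simp add: w)
  then have c: "continuous_on UNIV (\<lambda>p. w p $ i)" for i
    by (auto simp: partially_C1_def)
  have "\<forall>i. \<exists>wt wx. continuous_on UNIV (wt) \<and> continuous_on UNIV (wx) \<and>
      (\<forall>t x. ((\<lambda>t. w (t, x) $ i) has_real_derivative wt (t, x)) (at t) \<and>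
             ((\<lambda>x. w (t, x) $ i) has_real_derivative wx (t, x)) (at x))"
    using C1 by (simp add: partially_C1_def)
  from choice[OF this] obtain wt where "\<forall>i. \<exists>wx. continuous_on UNIV (wt i) \<and> continuous_on UNIV (wx) \<and>
      (\<forall>t x. ((\<lambda>t. w (t, x) $ i) has_real_derivative wt i (t, x)) (at t) \<and>
             ((\<lambda>x. w (t, x) $ i) has_real_derivative wx (t, x)) (at x))" ..
  from choice[OF this] obtain wx where d: "\<forall>i. continuous_on UNIV (wt i) \<and> continuous_on UNIV (wx i) \<and>
      (\<forall>t x. ((\<lambda>t. w (t, x) $ i) has_real_derivative wt i (t, x)) (at t) \<and>
             ((\<lambda>x. w (t, x) $ i) has_real_derivative wx i (t, x)) (at x))" ..
  have dp: "((\<lambda>t. w (t, snd p) $ i) has_real_derivative wt i p) (at (fst p))"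
    "((\<lambda>x. w (fst p, x) $ i) has_real_derivative wx i p) (at (snd p))" for p i
    using d by (metis prod.collapse)+
  show "continuous_on UNIV w"
    using continuous_on_vec_lambda[of UNIV "\<lambda>i p. w p $ i"] c by simp
  have "D_t w = (\<lambda>p. \<chi> i. wt i p)"
    unfolding D_t_def by (intro ext vector_derivative_at has_vector_derivative_vec) (simp add: dp)
  then show "continuous_on UNIV (D_t w)"
    by (simp add: continuous_on_vec_lambda d)
  have "D_x w = (\<lambda>p. \<chi> i. wx i p)"
    unfolding D_x_def by (intro ext vector_derivative_at has_vector_derivative_vec) (simp add: dp)
  then show "continuous_on UNIV (D_x w)"
    by (simp add: continuous_on_vec_lambda d)
qed

lemma nn_integral_cbox_continuous:
  fixes g :: "'a::euclidean_space \<Rightarrow> real"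
  assumes g: "continuous_on UNIV g" and "\<And>x. 0 \<le> g x"
  shows "(\<integral>\<^sup>+x\<in>cbox a b. ennreal (g x) \<partial>lborel) = ennreal (integral (cbox a b) g)"
proof -
  have int: "set_integrable lborel (cbox a b) g"
    unfolding set_integrable_def using g
    by (intro borel_integrable_compact) (auto intro: continuous_on_subset)
  have "(\<integral>\<^sup>+x\<in>cbox a b. ennreal (g x) \<partial>lborel) = (\<integral>\<^sup>+x. ennreal (indicator (cbox a b) x *\<^sub>R g x) \<partial>lborel)"
    by (intro nn_integral_cong) (simp add: indicator_def)
  also have "\<dots> = ennreal (LINT x:cbox a b|lborel. g x)"
    using int assms(2) unfolding set_integrable_def set_lebesgue_integral_def
    by (intro nn_integral_eq_integral) auto
  finally show ?thesis
    using set_borel_integral_eq_integral(2)[OF int] by simp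
qed

lemma L2_norm_sq_add:
  assumes "continuous_on UNIV w" "continuous_on UNIV z" and X: "X \<in> sets borel"
  shows "L2_norm_sq X w + L2_norm_sq X z = (\<integral>\<^sup>+x\<in>X. ennreal ((norm (w x))\<^sup>2 + (norm (z x))\<^sup>2) \<partial>lborel)"
proof -
  have [measurable]: "w \<in> borel_measurable borel" "z \<in> borel_measurable borel" "X \<in> sets borel"
    using assms by (auto intro: borel_measurable_continuous_onI)
  show ?thesis
    unfolding L2_norm_sq_def by (subst nn_integral_add[symmetric]) (auto simp: distrib_right)
qed

lemma nn_integral_iterated:
  fixes g :: "real \<times> real \<Rightarrow> real"
  assumes g: "continuous_on UNIV g" and [measurable]: "A \<in> sets borel" "X \<in> sets borel"
  shows "(\<integral>\<^sup>+t\<in>A. (\<integral>\<^sup>+x\<in>X. ennreal (g (t, x)) \<partial>lborel) \<partial>lborel) = (\<integral>\<^sup>+p\<in>A \<times> X. ennreal (g p) \<partial>lborel)"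
proof -
  have [measurable]: "g \<in> borel_measurable borel"
    using g by (rule borel_measurable_continuous_onI)
  have m: "(\<lambda>p. ennreal (g p) * indicator (A \<times> X) p) \<in> borel_measurable (lborel \<Otimes>\<^sub>M lborel)"
    unfolding lborel_prod using borel_Times[OF assms(2,3)] by measurable
  have [measurable]: "(\<lambda>x. g (t, x)) \<in> borel_measurable borel" for t
    by (intro borel_measurable_continuous_onI continuous_on_compose2[OF g]) (auto intro!: continuous_intros)
  have "(\<integral>\<^sup>+t\<in>A. (\<integral>\<^sup>+x\<in>X. ennreal (g (t, x)) \<partial>lborel) \<partial>lborel) =
      (\<integral>\<^sup>+t. \<integral>\<^sup>+x. ennreal (g (t, x)) * indicator (A \<times> X) (t, x) \<partial>lborel \<partial>lborel)"
    by (subst nn_integral_multc[symmetric]) (auto intro!: nn_integral_cong simp: indicator_def)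
  also have "\<dots> = (\<integral>\<^sup>+p\<in>A \<times> X. ennreal (g p) \<partial>lborel)"
    using lborel.nn_integral_fst[OF m] by (simp add: lborel_prod)
  finally show ?thesis .
qed

lemma gen_error_sq_eq_integrals:
  fixes u v :: "real \<times> real \<Rightarrow> real ^ 'n"
  assumes u: "continuous_on UNIV u" "continuous_on UNIV (D_x u)"
    and v: "continuous_on UNIV v" "continuous_on UNIV (D_x v)"
    and R: "continuous_on UNIV (R_iu u v)" "continuous_on UNIV (R_iv \<epsilon> f A u v)"
      "continuous_on UNIV (R_t u0 u)" "continuous_on UNIV (R_t v0 v)"
    and X: "X \<in> sets borel"
  shows "gen_error_sq X T \<epsilon> f A u0 v0 lam u v =
    (\<integral>\<^sup>+p\<in>{0..T} \<times> X. ennreal (interior_density \<epsilon> f A u v p) \<partial>lborel)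
    + (\<integral>\<^sup>+x\<in>X. ennreal (initial_density u0 v0 u v x) \<partial>lborel)
    + ennreal lam * (\<integral>\<^sup>+p\<in>{0..T} \<times> X. ennreal (penalty_density u v p) \<partial>lborel)"
proof -
  have slice: "continuous_on UNIV (\<lambda>x. w (t, x))" if "continuous_on UNIV w" for w :: "real \<times> real \<Rightarrow> real ^ 'n" and t
    by (intro continuous_on_compose2[OF that]) (auto intro!: continuous_intros)
  have dens: "continuous_on UNIV (interior_density \<epsilon> f A u v)" "continuous_on UNIV (penalty_density u v)"
    unfolding interior_density_def[abs_def] penalty_density_def[abs_def] by (intro continuous_intros u v R)+
  have i: "L2_norm_sq X (\<lambda>x. R_iu u v (t, x)) + L2_norm_sq X (\<lambda>x. R_iv \<epsilon> f A u v (t, x)) =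
      (\<integral>\<^sup>+x\<in>X. ennreal (interior_density \<epsilon> f A u v (t, x)) \<partial>lborel)" for t
    unfolding interior_density_def by (intro L2_norm_sq_add slice R X)
  have t: "L2_norm_sq X (R_t u0 u) + L2_norm_sq X (R_t v0 v) =
      (\<integral>\<^sup>+x\<in>X. ennreal (initial_density u0 v0 u v x) \<partial>lborel)"
    unfolding initial_density_def by (intro L2_norm_sq_add R X)
  have p: "H1_norm_sq X (\<lambda>x. u (t, x)) + H1_norm_sq X (\<lambda>x. v (t, x)) =
      (\<integral>\<^sup>+x\<in>X. ennreal (penalty_density u v (t, x)) \<partial>lborel)" for t
  proof -
    have "H1_norm_sq X (\<lambda>x. u (t, x)) + H1_norm_sq X (\<lambda>x. v (t, x)) =
        (L2_norm_sq X (\<lambda>x. u (t, x)) + L2_norm_sq X (\<lambda>x. v (t, x))) +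
        (L2_norm_sq X (\<lambda>x. D_x u (t, x)) + L2_norm_sq X (\<lambda>x. D_x v (t, x)))"
      by (simp add: H1_norm_sq_def D_x_def add_ac)
    also have "\<dots> = (\<integral>\<^sup>+x\<in>X. ennreal ((norm (u (t, x)))\<^sup>2 + (norm (v (t, x)))\<^sup>2) \<partial>lborel) +
        (\<integral>\<^sup>+x\<in>X. ennreal ((norm (D_x u (t, x)))\<^sup>2 + (norm (D_x v (t, x)))\<^sup>2) \<partial>lborel)"
      by (simp only: L2_norm_sq_add slice u v X)
    also have "\<dots> = (\<integral>\<^sup>+x\<in>X. ennreal (penalty_density u v (t, x)) \<partial>lborel)"
    proof -
      have [measurable]: "(\<lambda>x. u (t, x)) \<in> borel_measurable borel" "(\<lambda>x. v (t, x)) \<in> borel_measurable borel"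
        "(\<lambda>x. D_x u (t, x)) \<in> borel_measurable borel" "(\<lambda>x. D_x v (t, x)) \<in> borel_measurable borel"
        "X \<in> sets borel"
        by (intro borel_measurable_continuous_onI slice u v X)+
      show ?thesis
        unfolding penalty_density_def
        by (subst nn_integral_add[symmetric]) (auto simp flip: distrib_right)
    qed
    finally show ?thesis .
  qed
  show ?thesis
    unfolding gen_error_sq_def i p using nn_integral_iterated[OF dens(1) _ X, of "{0..T}"]
      nn_integral_iterated[OF dens(2) _ X, of "{0..T}"] t
    by (simp add: add.assoc)
qed

lemma abs_sqrt_diff_le:
  assumes "0 \<le> a" "0 \<le> b"
  shows "\<bar>sqrt a - sqrt b\<bar> \<le> sqrt \<bar>a - b\<bar>"
proof (rule real_le_rsqrt)
  have "\<bar>sqrt a - sqrt b\<bar> * \<bar>sqrt a - sqrt b\<bar> \<le> \<bar>sqrt a - sqrt b\<bar> * \<bar>sqrt a + sqrt b\<bar>"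
    using assms by (intro mult_left_mono) (auto simp: abs_le_iff)
  also have "\<dots> = \<bar>a - b\<bar>"
    unfolding abs_mult[symmetric] using assms by (simp add: algebra_simps)
  finally show "\<bar>sqrt a - sqrt b\<bar>\<^sup>2 \<le> \<bar>a - b\<bar>"
    by (simp add: power2_eq_square)
qed

lemma ennsqrt_error:
  assumes "0 \<le> a" "0 \<le> b" and R: "ennreal \<bar>a - b\<bar> \<le> R"
  shows "\<bar>enn2ereal (ennsqrt (ennreal a + e)) - ereal (sqrt b)\<bar> \<le> enn2ereal (ennsqrt (R + e))"
proof (cases "R = top \<or> e = top")
  case True
  then show ?thesis
    by (auto simp: ennsqrt_def top_ereal_def)
next
  case False
  then obtain r e' where r: "R = ennreal r" "0 \<le> r" "e = ennreal e'" "0 \<le> e'"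
    by (metis ennreal_cases)
  then have "\<bar>a - b\<bar> \<le> r"
    using R by simp
  have "\<bar>sqrt (a + e') - sqrt b\<bar> \<le> sqrt \<bar>a + e' - b\<bar>"
    using assms r by (intro abs_sqrt_diff_le) auto
  also have "\<dots> \<le> sqrt (r + e')"
    using \<open>\<bar>a - b\<bar> \<le> r\<close> r by simp
  finally show ?thesis
    using r assms by (simp add: ennsqrt_def flip: ennreal_plus)
qed

theorem theorem3p12:
  fixes f :: "real ^ 'n \<Rightarrow> real ^ 'n" and A :: "real ^ 'n ^ 'n"
    and u0 v0 :: "real \<Rightarrow> real ^ 'n"
    and \<epsilon> s T L lam :: real
    and \<sigma> :: "real \<Rightarrow> real" and \<theta> :: "'n params"
    and u v :: "real \<times> real \<Rightarrow> real ^ 'n"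
    and Si :: "(real \<times> real) set" and St :: "real set"
    and wi :: "real \<times> real \<Rightarrow> real" and wt :: "real \<Rightarrow> real"
    and Mi Mt :: nat
    and Ci Ct Cp :: ennreal
  assumes "\<epsilon> > 0" and "smooth f"
    and "transpose A = A" and "\<And>z. z \<noteq> 0 \<Longrightarrow> z \<bullet> (A *v z) > 0"
    and "s \<ge> 1" and "\<And>i. in_H s (\<lambda>x. u0 x $ i)" and "continuous_on UNIV u0"
    and "v0 = f \<circ> u0"
    and "smooth \<sigma>" and "well_formed_params \<theta>"
    and "u = net_u \<sigma> \<theta>" and "v = net_v \<sigma> \<theta>"
    and "T > 0" and "L > 0"
    and "cube_midpoints (cbox (0, - L) (T, L)) Si" and "Mi = card Si"
    and "cube_midpoints (cbox (- L) L) St" and "Mt = card St"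
    and "\<And>p. p \<in> Si \<Longrightarrow> wi p = 2 * L * T / real Mi"
    and "\<And>x. x \<in> St \<Longrightarrow> wt x = 2 * L / real Mt"
    and "lam > 0"
    and "Ci = ennreal ((L * T)\<^sup>2 / 3) * W_inf_norm 2 (box (0, - L) (T, L)) (interior_density \<epsilon> f A u v)"
    and "Ct = ennreal (L ^ 3 / 3) * W_inf_norm 2 (box (- L) L) (initial_density u0 v0 u v)"
    and "Cp = ennreal ((L * T)\<^sup>2 / 3) * W_inf_norm 2 (box (0, - L) (T, L)) (penalty_density u v)"
  shows
    "\<bar>enn2ereal (gen_error {- L..L} T \<epsilon> f A u0 v0 lam u v)
        - ereal (train_error Si St wi wt \<epsilon> f A u0 v0 lam u v)\<bar>
      \<le> enn2ereal (ennsqrt (Ci / of_nat Mi + Ct / of_nat (Mt\<^sup>2) + ennreal lam * Cp / of_nat Mi))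
     \<and>
     \<bar>enn2ereal (gen_error UNIV T \<epsilon> f A u0 v0 lam u v)
        - ereal (train_error Si St wi wt \<epsilon> f A u0 v0 lam u v)\<bar>
      \<le> enn2ereal (ennsqrt (Ci / of_nat Mi + Ct / of_nat (Mt\<^sup>2) + ennreal lam * Cp / of_nat Mi
            + gen_error_sq (- {- L..L}) T \<epsilon> f A u0 v0 lam u v))"
proof -
  have u: "continuous_on UNIV u" "continuous_on UNIV (D_t u)" "continuous_on UNIV (D_x u)"
    by (rule network_partial_derivatives_continuous[OF \<open>smooth \<sigma>\<close>, where out = "out_u \<theta>" and ls = "hidden \<theta>"];
        simp add: \<open>u = net_u \<sigma> \<theta>\<close> net_u_def)+
  have v: "continuous_on UNIV v" "continuous_on UNIV (D_t v)" "continuous_on UNIV (D_x v)"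
    by (rule network_partial_derivatives_continuous[OF \<open>smooth \<sigma>\<close>, where out = "out_v \<theta>" and ls = "hidden \<theta>"];
        simp add: \<open>v = net_v \<sigma> \<theta>\<close> net_v_def)+
  have f: "continuous_on UNIV f"
    using \<open>smooth f\<close> by (rule smooth_imp_continuous_on)
  have v0: "continuous_on UNIV v0"
    unfolding \<open>v0 = f \<circ> u0\<close> o_def by (intro continuous_on_compose2[OF f] \<open>continuous_on UNIV u0\<close>) simp
  have slice: "continuous_on UNIV (\<lambda>x. w (0, x))" if "continuous_on UNIV w" for w :: "real \<times> real \<Rightarrow> real ^ 'n"
    by (intro continuous_on_compose2[OF that]) (auto intro!: continuous_intros)
  have R: "continuous_on UNIV (R_iu u v)" "continuous_on UNIV (R_iv \<epsilon> f A u v)"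
    "continuous_on UNIV (R_t u0 u)" "continuous_on UNIV (R_t v0 v)"
    unfolding R_iu_def[abs_def] R_iv_def[abs_def] R_t_def[abs_def]
    by (intro continuous_intros u v slice v0 \<open>continuous_on UNIV u0\<close> continuous_on_compose2[OF f]
        bounded_linear.continuous_on[OF matrix_vector_mul_bounded_linear] subset_UNIV)+
  let ?i = "interior_density \<epsilon> f A u v" and ?t = "initial_density u0 v0 u v" and ?p = "penalty_density u v"
  have dens: "continuous_on UNIV ?i" "continuous_on UNIV ?t" "continuous_on UNIV ?p"
    unfolding interior_density_def[abs_def] initial_density_def[abs_def] penalty_density_def[abs_def]
    by (intro continuous_intros u v R)+
  have nonneg: "0 \<le> ?i p" "0 \<le> ?t x" "0 \<le> ?p p" for p x
    by (simp_all add: interior_density_def initial_density_def penalty_density_def)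
  note G = gen_error_sq_eq_integrals[OF u(1,3) v(1,3) R]
  let ?Q = "cbox (0, - L) (T, L)"
  have Q: "{0..T} \<times> {- L..L} = ?Q"
    by (simp add: cbox_Pair_eq)
  define a where "a = integral ?Q ?i + integral (cbox (- L) L) ?t + lam * integral ?Q ?p"
  define b where "b = (\<Sum>p\<in>Si. 2 * L * T / real (card Si) * ?i p) + (\<Sum>x\<in>St. 2 * L / real (card St) * ?t x)
    + lam * (\<Sum>p\<in>Si. 2 * L * T / real (card Si) * ?p p)"
  have int_nonneg: "0 \<le> integral ?Q ?i" "0 \<le> integral (cbox (- L) L) ?t" "0 \<le> integral ?Q ?p"
    by (intro integral_nonneg integrable_continuous continuous_on_subset[OF dens(1)]
        continuous_on_subset[OF dens(2)] continuous_on_subset[OF dens(3)] nonneg subset_UNIV)+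
  have "0 \<le> a"
    unfolding a_def using int_nonneg \<open>lam > 0\<close> by simp
  have "0 \<le> b"
    unfolding b_def using nonneg \<open>lam > 0\<close> \<open>T > 0\<close> \<open>L > 0\<close>
    by (intro add_nonneg_nonneg mult_nonneg_nonneg sum_nonneg) auto
  have train: "train_error Si St wi wt \<epsilon> f A u0 v0 lam u v = sqrt b"
    unfolding train_error_def b_def using assms(16,18,19,20) by simp
  have gen: "gen_error_sq {- L..L} T \<epsilon> f A u0 v0 lam u v = ennreal a"
  proof -
    have "gen_error_sq {- L..L} T \<epsilon> f A u0 v0 lam u v =
        ennreal (integral ?Q ?i) + ennreal (integral (cbox (- L) L) ?t) + ennreal lam * ennreal (integral ?Q ?p)"
      using nn_integral_cbox_continuous[OF dens(1) nonneg(1), of "(0, - L)" "(T, L)"]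
        nn_integral_cbox_continuous[OF dens(2) nonneg(2), of "- L" L]
        nn_integral_cbox_continuous[OF dens(3) nonneg(3), of "(0, - L)" "(T, L)"]
      by (simp add: G Q)
    also have "\<dots> = ennreal a"
      unfolding a_def using int_nonneg \<open>lam > 0\<close> by (simp add: ennreal_mult ennreal_plus)
    finally show ?thesis .
  qed
  have gen_UNIV: "gen_error_sq UNIV T \<epsilon> f A u0 v0 lam u v =
      ennreal a + gen_error_sq (- {- L..L}) T \<epsilon> f A u0 v0 lam u v"
  proof -
    have X: "UNIV \<in> sets borel" "{- L..L} \<in> sets borel" "- {- L..L} \<in> sets borel"
      by auto
    have m [measurable]: "?i \<in> borel_measurable borel" "?t \<in> borel_measurable borel" "?p \<in> borel_measurable borel"
      by (intro borel_measurable_continuous_onI dens)+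
    have "{0..T} \<times> X \<in> sets borel" if "X \<in> sets borel" for X :: "real set"
      using that by (intro borel_Times) auto
    then have [measurable]: "{0..T} \<times> {- L..L} \<in> sets borel" "{0..T} \<times> (- {- L..L}) \<in> sets borel"
      by auto
    have split2: "(\<integral>\<^sup>+p\<in>{0..T} \<times> UNIV. ennreal (g p) \<partial>lborel) =
        (\<integral>\<^sup>+p\<in>{0..T} \<times> {- L..L}. ennreal (g p) \<partial>lborel) + (\<integral>\<^sup>+p\<in>{0..T} \<times> (- {- L..L}). ennreal (g p) \<partial>lborel)"
      if [measurable]: "g \<in> borel_measurable borel" for g :: "real \<times> real \<Rightarrow> real"
    proof -
      have "{0..T} \<times> UNIV = {0..T} \<times> {- L..L} \<union> {0..T} \<times> (- {- L..L})"
        by auto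
      then show ?thesis
        by (simp only:) (rule nn_integral_disjoint_pair, measurable, blast)
    qed
    have split1: "(\<integral>\<^sup>+x\<in>UNIV. ennreal (?t x) \<partial>lborel) =
        (\<integral>\<^sup>+x\<in>{- L..L}. ennreal (?t x) \<partial>lborel) + (\<integral>\<^sup>+x\<in>- {- L..L}. ennreal (?t x) \<partial>lborel)"
      by (subst Compl_partition[of "{- L..L}", symmetric]) (rule nn_integral_disjoint_pair; simp)
    show ?thesis
      unfolding gen[symmetric] G[OF X(1)] G[OF X(2)] G[OF X(3)] split1 split2[OF m(1)] split2[OF m(3)]
      by (simp only: distrib_left add_ac)
  qed
  have err: "ennreal \<bar>a - b\<bar> \<le> Ci / of_nat Mi + Ct / of_nat (Mt\<^sup>2) + ennreal lam * Cp / of_nat Mi"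
  proof -
    define ei where "ei = \<bar>integral ?Q ?i - (\<Sum>p\<in>Si. 2 * L * T / real (card Si) * ?i p)\<bar>"
    define et where "et = \<bar>integral (cbox (- L) L) ?t - (\<Sum>x\<in>St. 2 * L / real (card St) * ?t x)\<bar>"
    define ep where "ep = \<bar>integral ?Q ?p - (\<Sum>p\<in>Si. 2 * L * T / real (card Si) * ?p p)\<bar>"
    have "a - b = (integral ?Q ?i - (\<Sum>p\<in>Si. 2 * L * T / real (card Si) * ?i p))
        + (integral (cbox (- L) L) ?t - (\<Sum>x\<in>St. 2 * L / real (card St) * ?t x))
        + lam * (integral ?Q ?p - (\<Sum>p\<in>Si. 2 * L * T / real (card Si) * ?p p))"
      unfolding a_def b_def by (simp only: right_diff_distrib)
    moreover have "\<bar>x + y + lam * z\<bar> \<le> \<bar>x\<bar> + \<bar>y\<bar> + lam * \<bar>z\<bar>" for x y z :: real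
      using abs_triangle_ineq[of "x + y" "lam * z"] abs_triangle_ineq[of x y] \<open>lam > 0\<close> by (simp add: abs_mult)
    ultimately have "\<bar>a - b\<bar> \<le> ei + et + lam * ep"
      by (simp only: ei_def et_def ep_def)
    then have "ennreal \<bar>a - b\<bar> \<le> ennreal (ei + et + lam * ep)"
      by (rule ennreal_leI)
    also have "\<dots> = ennreal ei + ennreal et + ennreal lam * ennreal ep"
      using \<open>lam > 0\<close> by (simp add: ei_def et_def ep_def ennreal_mult ennreal_plus)
    also have "\<dots> \<le> Ci / of_nat Mi + Ct / of_nat (Mt\<^sup>2) + ennreal lam * (Cp / of_nat Mi)"
      unfolding \<open>Mi = card Si\<close> \<open>Mt = card St\<close> assms(22,23,24) ei_def et_def ep_def
      by (intro add_mono mult_left_mono quadrature_error_1d quadrature_error_2d assms dens) simp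
    finally show ?thesis
      by (simp add: ennreal_times_divide)
  qed
  show ?thesis
    using ennsqrt_error[OF \<open>0 \<le> a\<close> \<open>0 \<le> b\<close> err, of 0] ennsqrt_error[OF \<open>0 \<le> a\<close> \<open>0 \<le> b\<close> err]
    by (simp add: gen_error_def train gen gen_UNIV)
qed

end
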